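(* Let $M$ be a smooth manifold and let $F$ be a strongly convex Finsler metric on $M$. Then $F$ is of Randers type if and only if $F$ solves the Zermelo navigation problem on some Riemannian manifold $(M,h)$ under the influence of some wind (vector field) $W$ on $M$ with $h(W,W)<1$ everywhere. Moreover, in this situation $F$ is Riemannian if and only if $W=0$.
   Context: A Finsler metric $F:TM\to[0,\infty)$ is smooth on $TM\setminus 0$ and positively homogeneous of degree one on each tangent space; it is strongly convex if the matrix $g_{ij}=\frac12 (F^2)_{y^iy^j}$ is positive definite at every $(x,y)$ with $y\neq 0$. $F$ is of Randers type if $F(x,y)=\sqrt{a_{ij}(x)y^iy^j}+b_i(x)y^i$ with $a$ a Riemannian metric and $b=b_i\,dx^i$ a 1-form on $M$. (A Randers metric is strongly convex iff $\|b\|^2:=a^{ij}b_ib_j<1$.) Given a Riemannian metric $h$ and a vector field $W$ with $h(W,W)<1$, one says that $F$ solves the Zermelo navigation problem on $(M,h)$ under the influence of the wind $W$ if in each tangent space $T_xM$ the unit sphere $\{F=1\}$ is the translate by $W(x)$ of the unit sphere of $h$; equivalently, with $\lambda:=1-h(W,W)$, $$F(y)=\frac{\sqrt{[h(W,y)]^2+\lambda\, h(y,y)}}{\lambda}-\frac{h(W,y)}{\lambda}.$$ $F$ is Riemannian if $F(x,y)=\sqrt{a_{ij}(x)y^iy^j}$ for some Riemannian metric $a$. *)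

theory Defs
  imports "HOL-Analysis.Analysis" "HOL-Library.Function_Algebras"
begin

section \<open>Functions as vectors\<close>

instantiation "fun" :: (type, real_vector) real_vector
begin

definition "r *\<^sub>R f = (\<lambda>x. r *\<^sub>R f x)"

instance
  by standard
    (simp_all add: fun_eq_iff scaleR_fun_def scaleR_add_right scaleR_add_left)

end

section \<open>Smooth maps on open subsets of normed spaces\<close>

text \<open>The following is used only for open \<^term>\<open>S\<close>; for finite-dimensional domains
  \<open>Ck_on k f S\<close> then says that \<^term>\<open>f\<close> is of class $C^k$ on \<^term>\<open>S\<close>.\<close>

primrec Ck_on :: "nat \<Rightarrow> ('v::real_normed_vector \<Rightarrow> 'w::real_normed_vector) \<Rightarrow> 'v set \<Rightarrow> bool" where
  "Ck_on 0 = (\<lambda>f S. continuous_on S f)"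
| "Ck_on (Suc k) = (\<lambda>f S. (\<forall>x\<in>S. f differentiable (at x)) \<and>
      (\<forall>v. Ck_on k (\<lambda>x. frechet_derivative f (at x) v) S))"

definition smooth_on :: "('v::real_normed_vector \<Rightarrow> 'w::real_normed_vector) \<Rightarrow> 'v set \<Rightarrow> bool" where
  "smooth_on f S \<longleftrightarrow> (\<forall>k. Ck_on k f S)"

section \<open>Smooth manifolds\<close>

text \<open>A chart is a domain together with a coordinate map; the values of the map outside the
  domain are irrelevant.\<close>

type_synonym ('a, 'e) chart = "'a set \<times> ('a \<Rightarrow> 'e)"

abbreviation chart_dom :: "('a, 'e) chart \<Rightarrow> 'a set" where
  "chart_dom \<equiv> fst"

abbreviation chart_map :: "('a, 'e) chart \<Rightarrow> 'a \<Rightarrow> 'e" where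
  "chart_map \<equiv> snd"

definition chart_inv :: "('a, 'e) chart \<Rightarrow> 'e \<Rightarrow> 'a" where
  "chart_inv c = inv_into (chart_dom c) (chart_map c)"

definition chart_image :: "('a, 'e) chart \<Rightarrow> 'e set" where
  "chart_image c = chart_map c ` chart_dom c"

definition transition :: "('a, 'e) chart \<Rightarrow> ('a, 'e) chart \<Rightarrow> 'e \<Rightarrow> 'e" where
  "transition c d = chart_map d \<circ> chart_inv c"

text \<open>\<^term>\<open>\<A>\<close> is an arbitrary smooth atlas, maximal or not. The notions below depend only
  on the smooth structure which it generates.\<close>

definition smooth_manifold :: "'a topology \<Rightarrow> ('a, 'e::euclidean_space) chart set \<Rightarrow> bool" where
  "smooth_manifold X \<A> \<longleftrightarrow>
     Hausdorff_space X \<and> second_countable X \<and>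
     (\<Union>c\<in>\<A>. chart_dom c) = topspace X \<and>
     (\<forall>c\<in>\<A>. openin X (chart_dom c) \<and> open (chart_image c) \<and>
        homeomorphic_map (subtopology X (chart_dom c)) (top_of_set (chart_image c)) (chart_map c)) \<and>
     (\<forall>c\<in>\<A>. \<forall>d\<in>\<A>. smooth_on (transition c d) (chart_map c ` (chart_dom c \<inter> chart_dom d)))"

definition charts_at :: "('a, 'e) chart set \<Rightarrow> 'a \<Rightarrow> ('a, 'e) chart set" where
  "charts_at \<A> p = {c\<in>\<A>. p \<in> chart_dom c}"

section \<open>Tangent spaces\<close>

text \<open>A tangent vector at \<^term>\<open>p\<close> is a family of coordinate vectors, one for each chart around
  \<^term>\<open>p\<close>, which transforms by the differentials of the transition maps. The value at all other
  charts is normalised to zero, so that equality of tangent vectors is equality of functions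
  and the tangent space is a linear subspace of a function space.\<close>

type_synonym ('a, 'e) tvec = "('a, 'e) chart \<Rightarrow> 'e"

definition tangent_space ::
    "('a, 'e::euclidean_space) chart set \<Rightarrow> 'a \<Rightarrow> ('a, 'e) tvec set" where
  "tangent_space \<A> p = {v.
     (\<forall>c\<in>charts_at \<A> p. \<forall>d\<in>charts_at \<A> p.
        v d = frechet_derivative (transition c d) (at (chart_map c p)) (v c)) \<and>
     (\<forall>c. c \<notin> charts_at \<A> p \<longrightarrow> v c = 0)}"

text \<open>The tangent vector at \<^term>\<open>p\<close> whose coordinate vector in the chart \<^term>\<open>c\<close> around
  \<^term>\<open>p\<close> is \<^term>\<open>y\<close>.\<close>

definition tangent_of ::
    "('a, 'e::euclidean_space) chart set \<Rightarrow> ('a, 'e) chart \<Rightarrow> 'a \<Rightarrow> 'e \<Rightarrow> ('a, 'e) tvec" where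
  "tangent_of \<A> c p y = (\<lambda>d. if d \<in> charts_at \<A> p
     then frechet_derivative (transition c d) (at (chart_map c p)) y else 0)"

section \<open>Tensor fields\<close>

definition linear_form_on :: "'v::real_vector set \<Rightarrow> ('v \<Rightarrow> real) \<Rightarrow> bool" where
  "linear_form_on V f \<longleftrightarrow>
     (\<forall>u\<in>V. \<forall>v\<in>V. f (u + v) = f u + f v) \<and> (\<forall>r. \<forall>v\<in>V. f (r *\<^sub>R v) = r * f v)"

definition vector_field ::
    "'a topology \<Rightarrow> ('a, 'e::euclidean_space) chart set \<Rightarrow> ('a \<Rightarrow> ('a, 'e) tvec) \<Rightarrow> bool" where
  "vector_field X \<A> W \<longleftrightarrow>
     (\<forall>p\<in>topspace X. W p \<in> tangent_space \<A> p) \<and>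
     (\<forall>c\<in>\<A>. smooth_on (\<lambda>x. W (chart_inv c x) c) (chart_image c))"

definition one_form ::
    "'a topology \<Rightarrow> ('a, 'e::euclidean_space) chart set \<Rightarrow> ('a \<Rightarrow> ('a, 'e) tvec \<Rightarrow> real) \<Rightarrow> bool" where
  "one_form X \<A> b \<longleftrightarrow>
     (\<forall>p\<in>topspace X. linear_form_on (tangent_space \<A> p) (b p)) \<and>
     (\<forall>c\<in>\<A>. \<forall>i\<in>Basis. smooth_on
        (\<lambda>x. b (chart_inv c x) (tangent_of \<A> c (chart_inv c x) i)) (chart_image c))"

definition riemannian_metric ::
    "'a topology \<Rightarrow> ('a, 'e::euclidean_space) chart set
      \<Rightarrow> ('a \<Rightarrow> ('a, 'e) tvec \<Rightarrow> ('a, 'e) tvec \<Rightarrow> real) \<Rightarrow> bool" where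
  "riemannian_metric X \<A> a \<longleftrightarrow>
     (\<forall>p\<in>topspace X.
        (\<forall>u\<in>tangent_space \<A> p. linear_form_on (tangent_space \<A> p) (\<lambda>v. a p u v)) \<and>
        (\<forall>v\<in>tangent_space \<A> p. linear_form_on (tangent_space \<A> p) (\<lambda>u. a p u v)) \<and>
        (\<forall>u\<in>tangent_space \<A> p. \<forall>v\<in>tangent_space \<A> p. a p u v = a p v u) \<and>
        (\<forall>v\<in>tangent_space \<A> p. v \<noteq> 0 \<longrightarrow> a p v v > 0)) \<and>
     (\<forall>c\<in>\<A>. \<forall>i\<in>Basis. \<forall>j\<in>Basis. smooth_on
        (\<lambda>x. a (chart_inv c x) (tangent_of \<A> c (chart_inv c x) i)
                (tangent_of \<A> c (chart_inv c x) j)) (chart_image c))"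

section \<open>Finsler metrics\<close>

text \<open>\<^term>\<open>F p\<close> is the restriction of the metric to the tangent space at \<^term>\<open>p\<close>. Smoothness on
  the slit tangent bundle is expressed in the bundle charts induced by the charts of the base.\<close>

definition finsler_metric ::
    "'a topology \<Rightarrow> ('a, 'e::euclidean_space) chart set \<Rightarrow> ('a \<Rightarrow> ('a, 'e) tvec \<Rightarrow> real) \<Rightarrow> bool" where
  "finsler_metric X \<A> F \<longleftrightarrow>
     (\<forall>p\<in>topspace X. \<forall>v\<in>tangent_space \<A> p. F p v \<ge> 0) \<and>
     (\<forall>p\<in>topspace X. \<forall>v\<in>tangent_space \<A> p. \<forall>r>0. F p (r *\<^sub>R v) = r * F p v) \<and>
     (\<forall>c\<in>\<A>. smooth_on
        (\<lambda>(x, y). F (chart_inv c x) (tangent_of \<A> c (chart_inv c x) y))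
        (chart_image c \<times> (UNIV - {0})))"

definition partial_deriv :: "'e::euclidean_space \<Rightarrow> ('e \<Rightarrow> real) \<Rightarrow> 'e \<Rightarrow> real" where
  "partial_deriv i f y = frechet_derivative f (at y) i"

text \<open>The matrix $g_{ij}(x,y) = \frac12 (F^2)_{y^i y^j}$ in the chart \<^term>\<open>c\<close>, where
  \<^term>\<open>p\<close> is the point with coordinates $x$.\<close>

definition fundamental_matrix ::
    "('a, 'e::euclidean_space) chart set \<Rightarrow> ('a \<Rightarrow> ('a, 'e) tvec \<Rightarrow> real) \<Rightarrow> ('a, 'e) chart
      \<Rightarrow> 'a \<Rightarrow> 'e \<Rightarrow> 'e \<Rightarrow> 'e \<Rightarrow> real" where
  "fundamental_matrix \<A> F c p y i j =
     1/2 * partial_deriv j (partial_deriv i (\<lambda>z. (F p (tangent_of \<A> c p z))\<^sup>2)) y"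

definition strongly_convex ::
    "('a, 'e::euclidean_space) chart set \<Rightarrow> ('a \<Rightarrow> ('a, 'e) tvec \<Rightarrow> real) \<Rightarrow> bool" where
  "strongly_convex \<A> F \<longleftrightarrow>
     (\<forall>c\<in>\<A>. \<forall>p\<in>chart_dom c. \<forall>y. y \<noteq> 0 \<longrightarrow>
        (\<forall>u. u \<noteq> 0 \<longrightarrow>
          (\<Sum>i\<in>Basis. \<Sum>j\<in>Basis. fundamental_matrix \<A> F c p y i j * (u \<bullet> i) * (u \<bullet> j)) > 0))"

definition randers_type ::
    "'a topology \<Rightarrow> ('a, 'e::euclidean_space) chart set \<Rightarrow> ('a \<Rightarrow> ('a, 'e) tvec \<Rightarrow> real) \<Rightarrow> bool" where
  "randers_type X \<A> F \<longleftrightarrow>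
     (\<exists>a b. riemannian_metric X \<A> a \<and> one_form X \<A> b \<and>
        (\<forall>p\<in>topspace X. \<forall>v\<in>tangent_space \<A> p. F p v = sqrt (a p v v) + b p v))"

definition riemannian_type ::
    "'a topology \<Rightarrow> ('a, 'e::euclidean_space) chart set \<Rightarrow> ('a \<Rightarrow> ('a, 'e) tvec \<Rightarrow> real) \<Rightarrow> bool" where
  "riemannian_type X \<A> F \<longleftrightarrow>
     (\<exists>a. riemannian_metric X \<A> a \<and>
        (\<forall>p\<in>topspace X. \<forall>v\<in>tangent_space \<A> p. F p v = sqrt (a p v v)))"

text \<open>In each tangent space the unit sphere of \<^term>\<open>F\<close> is the translate by \<^term>\<open>W\<close> of the unit
  sphere of \<^term>\<open>h\<close>.\<close>

definition solves_zermelo ::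
    "'a topology \<Rightarrow> ('a, 'e::euclidean_space) chart set
      \<Rightarrow> ('a \<Rightarrow> ('a, 'e) tvec \<Rightarrow> ('a, 'e) tvec \<Rightarrow> real) \<Rightarrow> ('a \<Rightarrow> ('a, 'e) tvec)
      \<Rightarrow> ('a \<Rightarrow> ('a, 'e) tvec \<Rightarrow> real) \<Rightarrow> bool" where
  "solves_zermelo X \<A> h W F \<longleftrightarrow>
     (\<forall>p\<in>topspace X.
        {v \<in> tangent_space \<A> p. F p v = 1} =
        (\<lambda>u. W p + u) ` {u \<in> tangent_space \<A> p. sqrt (h p u u) = 1})"

definition wind ::
    "'a topology \<Rightarrow> ('a, 'e::euclidean_space) chart set
      \<Rightarrow> ('a \<Rightarrow> ('a, 'e) tvec \<Rightarrow> ('a, 'e) tvec \<Rightarrow> real) \<Rightarrow> ('a \<Rightarrow> ('a, 'e) tvec) \<Rightarrow> bool" where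
  "wind X \<A> h W \<longleftrightarrow> vector_field X \<A> W \<and> (\<forall>p\<in>topspace X. h p (W p) (W p) < 1)"

end

theory Submission
  imports Defs
begin

text \<open>Both directions are pointwise statements about quadratic forms on a tangent space, combined
  with the smoothness of the tensor fields that these forms define.

  Let \<open>F\<close> solve the navigation problem for \<open>h\<close> and \<open>W\<close>. As \<open>h(W, W) < 1\<close>, the origin lies inside
  the translated sphere, so homogeneity determines \<open>F v\<close> as the positive root of a quadratic
  equation (\<open>zermelo_formula\<close>). The root has the form \<open>sqrt a + b\<close> with \<open>a\<close> and \<open>b\<close> rational in
  \<open>h\<close> and \<open>W\<close>; hence \<open>F\<close> is of Randers type.

  Conversely let \<open>F = sqrt a + b\<close>, and let \<open>B\<close> be the vector dual to \<open>b\<close>. Strong convexity and Euler's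
  relation for the function \<open>F\<^sup>2\<close>, homogeneous of degree two, make \<open>F\<close> positive away from zero
  (\<open>strongly_convex_pos\<close>), so that \<open>b B < 1\<close>. Completing the square in \<open>a v v = (1 - b v)\<^sup>2\<close>
  shows that the unit sphere of \<open>F\<close> is a translated ellipsoid, with
  \<open>h = (1 - b B) (a - b \<otimes> b)\<close> and \<open>W = - B / (1 - b B)\<close> (\<open>navigation_sphere\<close>).
  The point where more than algebra is needed is the smoothness of \<open>B\<close>, which comes from
  orthogonalisation (\<open>smooth_riesz\<close>).

  Finally, a Riemannian norm is even, and the odd part of the navigation norm is
  \<open>- h(W, v) / (1 - h(W, W))\<close>, which vanishes for all \<open>v\<close> only if \<open>W = 0\<close>.\<close>

section \<open>Calculus of smooth maps\<close>

lemma Ck_on_cong: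
  fixes f g :: "'v::real_normed_vector \<Rightarrow> 'w::real_normed_vector"
  assumes "open S" "\<And>x. x \<in> S \<Longrightarrow> f x = g x" "Ck_on k f S"
  shows "Ck_on k g S"
  using assms(2,3)
proof (induction k arbitrary: f g)
  case 0
  then show ?case by (simp cong: continuous_on_cong)
next
  case (Suc k)
  have D: "(g has_derivative frechet_derivative f (at x)) (at x)" if "x \<in> S" for x
  proof (rule has_derivative_transform_within_open)
    show "(f has_derivative frechet_derivative f (at x)) (at x)"
      using Suc.prems(2) that by (simp add: frechet_derivative_works [symmetric])
  qed (use Suc.prems(1) that assms(1) in auto)
  then have E: "frechet_derivative f (at x) v = frechet_derivative g (at x) v" if "x \<in> S" for x v
    using frechet_derivative_at that by metis
  have "Ck_on k (\<lambda>x. frechet_derivative g (at x) v) S" for v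
    using Suc.IH [of "\<lambda>x. frechet_derivative f (at x) v"] E Suc.prems(2) by simp
  with D show ?case by (auto simp: differentiable_def)
qed

text \<open>An explicit derivative may replace \<^term>\<open>frechet_derivative\<close>. With this rule each closure
  property below is an induction on the order, in which the derivative of a combination is
  expressed by the parts and their derivatives.\<close>

lemma Ck_on_SucI:
  fixes f :: "'v::real_normed_vector \<Rightarrow> 'w::real_normed_vector"
  assumes "open S" "\<And>x. x \<in> S \<Longrightarrow> (f has_derivative f' x) (at x)"
    and "\<And>v. Ck_on k (\<lambda>x. f' x v) S"
  shows "Ck_on (Suc k) f S"
proof -
  have "Ck_on k (\<lambda>x. frechet_derivative f (at x) v) S" for v
    by (rule Ck_on_cong [OF assms(1) _ assms(3)[of v]]) (metis assms(2) frechet_derivative_at)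
  with assms(2) show ?thesis by (auto simp: differentiable_def)
qed

lemma Ck_on_Suc_has_derivative:
  assumes "Ck_on (Suc k) f S" "x \<in> S"
  shows "(f has_derivative frechet_derivative f (at x)) (at x)"
  using assms by (simp add: frechet_derivative_works [symmetric])

lemma Ck_on_Suc_derivative:
  assumes "Ck_on (Suc k) f S"
  shows "Ck_on k (\<lambda>x. frechet_derivative f (at x) v) S"
  using assms by simp

lemma Ck_on_SucD:
  assumes "Ck_on (Suc k) f S"
  shows "Ck_on k f S"
  using assms
proof (induction k arbitrary: f)
  case 0
  then show ?case
    by (auto intro!: continuous_at_imp_continuous_on differentiable_imp_continuous_within)
next
  case (Suc k)
  then show ?case by (metis Ck_on.simps(2))
qed

lemma Ck_on_const: 
  fixes S :: "'v::real_normed_vector set"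
  assumes "open S"
  shows "Ck_on k (\<lambda>x. c) S"
proof (induction k arbitrary: c)
  case (Suc k)
  show ?case by (rule Ck_on_SucI [OF assms has_derivative_const Suc])
qed simp

lemma Ck_on_add:
  assumes "open S" "Ck_on k f S" "Ck_on k g S"
  shows "Ck_on k (\<lambda>x. f x + g x) S"
  using assms(2,3)
proof (induction k arbitrary: f g)
  case 0
  then show ?case by (simp add: continuous_on_add)
next
  case (Suc k)
  show ?case
    by (rule Ck_on_SucI [OF assms(1) has_derivative_add [OF
          Ck_on_Suc_has_derivative [OF Suc.prems(1)] Ck_on_Suc_has_derivative [OF Suc.prems(2)]]
          Suc.IH [OF Ck_on_Suc_derivative [OF Suc.prems(1)] Ck_on_Suc_derivative [OF Suc.prems(2)]]])
qed

lemma (in bounded_bilinear) Ck_on: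
  assumes "open S" "Ck_on k f S" "Ck_on k g S"
  shows "Ck_on k (\<lambda>x. prod (f x) (g x)) S"
  using assms(2,3)
proof (induction k arbitrary: f g)
  case 0
  then show ?case by (simp add: continuous_on)
next
  case (Suc k)
  show ?case
    by (rule Ck_on_SucI [OF assms(1) FDERIV [OF
          Ck_on_Suc_has_derivative [OF Suc.prems(1)] Ck_on_Suc_has_derivative [OF Suc.prems(2)]]
          Ck_on_add [OF assms(1)
            Suc.IH [OF Ck_on_SucD [OF Suc.prems(1)] Ck_on_Suc_derivative [OF Suc.prems(2)]]
            Suc.IH [OF Ck_on_Suc_derivative [OF Suc.prems(1)] Ck_on_SucD [OF Suc.prems(2)]]]])
qed

lemma Ck_on_inverse:
  fixes f :: "'v::real_normed_vector \<Rightarrow> real"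
  assumes "open S" "Ck_on k f S" "\<And>x. x \<in> S \<Longrightarrow> f x \<noteq> 0"
  shows "Ck_on k (\<lambda>x. inverse (f x)) S"
  using assms(2)
proof (induction k)
  case 0
  then show ?case using assms(3) by (auto intro: continuous_on_inverse)
next
  case (Suc k)
  note mult = bounded_bilinear.Ck_on [OF bounded_bilinear_mult assms(1)]
  have inv: "Ck_on k (\<lambda>x. inverse (f x)) S"
    by (rule Suc.IH [OF Ck_on_SucD [OF Suc.prems]])
  show ?case
  proof (rule Ck_on_SucI [OF assms(1)])
    fix x assume x: "x \<in> S"
    show "((\<lambda>x. inverse (f x)) has_derivative
        (\<lambda>v. (- 1) * (inverse (f x) * frechet_derivative f (at x) v * inverse (f x)))) (at x)"
      using Deriv.has_derivative_inverse [OF assms(3)[OF x] Ck_on_Suc_has_derivative [OF Suc.prems x]]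
      by simp
  next
    fix v
    show "Ck_on k (\<lambda>x. (- 1) * (inverse (f x) * frechet_derivative f (at x) v * inverse (f x))) S"
      by (intro mult Ck_on_const assms(1) inv Ck_on_Suc_derivative [OF Suc.prems])
  qed
qed

lemma Ck_on_slice:
  fixes G :: "'u::real_normed_vector \<times> 'v::real_normed_vector \<Rightarrow> 'w::real_normed_vector"
  assumes "open V" "x \<in> U" "Ck_on k G (U \<times> V)"
  shows "Ck_on k (\<lambda>z. G (x, z)) V"
  using assms(3)
proof (induction k arbitrary: G)
  case 0
  have "continuous_on V (G \<circ> Pair x)"
    by (rule continuous_on_compose)
      (use 0 assms(2) in \<open>auto intro!: continuous_intros elim!: continuous_on_subset\<close>)
  then show ?case by (simp add: comp_def)
next
  case (Suc k)
  show ?case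
  proof (rule Ck_on_SucI [OF assms(1)])
    fix z assume z: "z \<in> V"
    have "(Pair x has_derivative (\<lambda>v. (0, v))) (at z)"
      by (auto intro!: derivative_eq_intros)
    moreover have "(G has_derivative frechet_derivative G (at (x, z))) (at (x, z))"
      using Ck_on_Suc_has_derivative [OF Suc.prems] z assms(2) by blast
    ultimately show "((\<lambda>z. G (x, z)) has_derivative
        (\<lambda>v. frechet_derivative G (at (x, z)) (0, v))) (at z)"
      by (rule has_derivative_compose)
  next
    fix v
    show "Ck_on k (\<lambda>z. frechet_derivative G (at (x, z)) (0, v)) V"
      by (rule Suc.IH [OF Ck_on_Suc_derivative [OF Suc.prems]])
  qed
qed

lemma smooth_on_cong:
  assumes "open S" "smooth_on f S" "\<And>x. x \<in> S \<Longrightarrow> g x = f x"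
  shows "smooth_on g S"
  using assms unfolding smooth_on_def by (metis Ck_on_cong)

lemma smooth_on_const: "open S \<Longrightarrow> smooth_on (\<lambda>x. c) S"
  unfolding smooth_on_def by (simp add: Ck_on_const)

lemma smooth_on_add:
  "\<lbrakk>open S; smooth_on f S; smooth_on g S\<rbrakk> \<Longrightarrow> smooth_on (\<lambda>x. f x + g x) S"
  unfolding smooth_on_def by (simp add: Ck_on_add)

lemma smooth_on_scaleR:
  "\<lbrakk>open S; smooth_on f S; smooth_on g S\<rbrakk> \<Longrightarrow> smooth_on (\<lambda>x. f x *\<^sub>R g x) S"
  unfolding smooth_on_def by (simp add: bounded_bilinear.Ck_on [OF bounded_bilinear_scaleR])

lemma smooth_on_inner:
  "\<lbrakk>open S; smooth_on f S; smooth_on g S\<rbrakk> \<Longrightarrow> smooth_on (\<lambda>x. f x \<bullet> g x) S"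
  unfolding smooth_on_def by (simp add: bounded_bilinear.Ck_on [OF bounded_bilinear_inner])

lemma smooth_on_mult:
  fixes f g :: "'v::real_normed_vector \<Rightarrow> real"
  shows "\<lbrakk>open S; smooth_on f S; smooth_on g S\<rbrakk> \<Longrightarrow> smooth_on (\<lambda>x. f x * g x) S"
  using smooth_on_scaleR [of S f g] by simp

lemma smooth_on_minus:
  assumes "open S" "smooth_on f S"
  shows "smooth_on (\<lambda>x. - f x) S"
  using smooth_on_scaleR [OF assms(1) smooth_on_const [OF assms(1), of "- 1"] assms(2)] by simp

lemma smooth_on_diff:
  assumes "open S" "smooth_on f S" "smooth_on g S"
  shows "smooth_on (\<lambda>x. f x - g x) S"
  using smooth_on_add [OF assms(1,2) smooth_on_minus [OF assms(1,3)]] by simp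

lemma smooth_on_sum:
  assumes "open S" "\<And>i. i \<in> I \<Longrightarrow> smooth_on (f i) S"
  shows "smooth_on (\<lambda>x. \<Sum>i\<in>I. f i x) S"
  using assms(2)
proof (induction I rule: infinite_finite_induct)
  case (insert i I)
  then show ?case by (simp add: smooth_on_add [OF assms(1)])
qed (simp_all add: smooth_on_const [OF assms(1)])

lemma smooth_on_divide:
  fixes f g :: "'v::real_normed_vector \<Rightarrow> real"
  assumes "open S" "smooth_on f S" "smooth_on g S" "\<And>x. x \<in> S \<Longrightarrow> g x \<noteq> 0"
  shows "smooth_on (\<lambda>x. f x / g x) S"
proof -
  have "smooth_on (\<lambda>x. inverse (g x)) S"
    using assms by (simp add: smooth_on_def Ck_on_inverse)
  from smooth_on_mult [OF assms(1,2) this] show ?thesis by (simp add: divide_inverse)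
qed

lemma smooth_on_has_derivative:
  assumes "smooth_on f S" "x \<in> S"
  shows "(f has_derivative frechet_derivative f (at x)) (at x)"
  using assms Ck_on_Suc_has_derivative unfolding smooth_on_def by blast

lemma smooth_on_derivative:
  assumes "smooth_on f S"
  shows "smooth_on (\<lambda>x. frechet_derivative f (at x) v) S"
  using assms Ck_on_Suc_derivative unfolding smooth_on_def by blast

lemma smooth_on_slice:
  assumes "open V" "x \<in> U" "smooth_on G (U \<times> V)"
  shows "smooth_on (\<lambda>z. G (x, z)) V"
  using assms Ck_on_slice unfolding smooth_on_def by blast

lemma smooth_on_euclidean:
  fixes f :: "'v::real_normed_vector \<Rightarrow> 'e::euclidean_space"
  assumes "open S" "smooth_on f S"
  shows "smooth_on (\<lambda>x. f x \<bullet> i) S"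
  by (intro smooth_on_inner smooth_on_const assms)

lemma smooth_on_bilinear_form:
  fixes A :: "'v::real_normed_vector \<Rightarrow> 'e::euclidean_space \<Rightarrow> 'e \<Rightarrow> real"
  assumes S: "open S" and bil: "\<And>x. x \<in> S \<Longrightarrow> bilinear (A x)"
    and smooth: "\<And>i j. i \<in> Basis \<Longrightarrow> j \<in> Basis \<Longrightarrow> smooth_on (\<lambda>x. A x i j) S"
    and f: "smooth_on f S" and g: "smooth_on g S"
  shows "smooth_on (\<lambda>x. A x (f x) (g x)) S"
proof (rule smooth_on_cong [OF S])
  show "smooth_on (\<lambda>x. \<Sum>(i, j)\<in>Basis \<times> Basis. (f x \<bullet> i) * ((g x \<bullet> j) * A x i j)) S"
    by (auto simp: split_beta
        intro!: smooth_on_sum smooth_on_mult smooth_on_euclidean S f g smooth)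
next
  fix x assume "x \<in> S"
  note b = bil [OF this]
  have "A x (f x) (g x) = A x (\<Sum>i\<in>Basis. (f x \<bullet> i) *\<^sub>R i) (\<Sum>j\<in>Basis. (g x \<bullet> j) *\<^sub>R j)"
    by (simp add: euclidean_representation)
  also have "\<dots> = (\<Sum>(i, j)\<in>Basis \<times> Basis. (f x \<bullet> i) * ((g x \<bullet> j) * A x i j))"
    by (simp add: bilinear_sum [OF b] bilinear_lmul [OF b] bilinear_rmul [OF b] mult.left_commute)
  finally show "A x (f x) (g x) = \<dots>" .
qed

lemma smooth_on_linear_form:
  fixes \<beta> :: "'v::real_normed_vector \<Rightarrow> 'e::euclidean_space \<Rightarrow> real"
  assumes S: "open S" and lin: "\<And>x. x \<in> S \<Longrightarrow> linear (\<beta> x)"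
    and smooth: "\<And>i. i \<in> Basis \<Longrightarrow> smooth_on (\<lambda>x. \<beta> x i) S"
    and f: "smooth_on f S"
  shows "smooth_on (\<lambda>x. \<beta> x (f x)) S"
proof (rule smooth_on_cong [OF S])
  show "smooth_on (\<lambda>x. \<Sum>i\<in>Basis. (f x \<bullet> i) * \<beta> x i) S"
    by (intro smooth_on_sum smooth_on_mult smooth_on_euclidean S f smooth)
next
  fix x assume "x \<in> S"
  from Linear_Algebra.linear_componentwise [OF lin [OF this], of "f x" 1]
  show "\<beta> x (f x) = (\<Sum>i\<in>Basis. (f x \<bullet> i) * \<beta> x i)" by simp
qed

text \<open>Raising an index keeps smoothness. Instead of inverting the matrix of the metric, the
  vector is built up one basis direction \<open>e\<close> at a time, as in Gram--Schmidt: the part \<open>e - u\<close>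
  of \<open>e\<close> that is orthogonal to the directions already treated corrects the value on \<open>e\<close> without
  spoiling the others, and only divisions by the nonvanishing function \<open>A x (e - u) e\<close> occur.\<close>

lemma smooth_riesz_on_span:
  fixes A :: "'v::real_normed_vector \<Rightarrow> 'e::euclidean_space \<Rightarrow> 'e \<Rightarrow> real"
  assumes S: "open S" and bil: "\<And>x. x \<in> S \<Longrightarrow> bilinear (A x)"
    and pos: "\<And>x y. x \<in> S \<Longrightarrow> y \<noteq> 0 \<Longrightarrow> A x y y > 0"
    and smooth: "\<And>i j. i \<in> Basis \<Longrightarrow> j \<in> Basis \<Longrightarrow> smooth_on (\<lambda>x. A x i j) S"
    and lin: "\<And>x. x \<in> S \<Longrightarrow> linear (\<beta> x)"
    and smooth': "\<And>i. i \<in> Basis \<Longrightarrow> smooth_on (\<lambda>x. \<beta> x i) S"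
    and I: "finite I" "I \<subseteq> Basis"
  shows "\<exists>w. smooth_on w S \<and> (\<forall>x\<in>S. w x \<in> span I \<and> (\<forall>i\<in>I. A x (w x) i = \<beta> x i))"
  using I lin smooth'
proof (induction I arbitrary: \<beta>)
  case empty
  show ?case by (rule exI [of _ "\<lambda>x. 0"]) (simp add: smooth_on_const S)
next
  case (insert e I)
  have e: "e \<in> Basis" "e \<notin> I" and IB: "I \<subseteq> Basis"
    using insert.hyps insert.prems(1) by auto
  obtain w where w: "smooth_on w S" "\<And>x. x \<in> S \<Longrightarrow> w x \<in> span I"
      "\<And>x i. x \<in> S \<Longrightarrow> i \<in> I \<Longrightarrow> A x (w x) i = \<beta> x i"
    using insert.IH [OF IB insert.prems(2,3)] by blast
  have "linear (A x e)" if "x \<in> S" for x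
    using bil [OF that] by (simp add: bilinear_def)
  from insert.IH [OF IB this smooth [OF e(1)]]
  obtain u where u: "smooth_on u S" "\<And>x. x \<in> S \<Longrightarrow> u x \<in> span I"
      "\<And>x i. x \<in> S \<Longrightarrow> i \<in> I \<Longrightarrow> A x (u x) i = A x e i"
    by blast
  define f where "f x = e - u x" for x
  have f: "smooth_on f S"
    unfolding f_def by (intro smooth_on_diff smooth_on_const S u(1))
  have orth: "A x (f x) i = 0" if "x \<in> S" "i \<in> span I" for x i
  proof -
    have "linear (A x (f x))" using bil [OF that(1)] by (simp add: bilinear_def)
    moreover have "A x (f x) j = 0" if "j \<in> I" for j
      using u(3) [OF \<open>x \<in> S\<close> that] by (simp add: f_def bilinear_lsub [OF bil [OF \<open>x \<in> S\<close>]])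
    ultimately show ?thesis
      using linear_eq_0_on_span [of "A x (f x)" I i] that(2) by simp
  qed
  have nz: "A x (f x) e \<noteq> 0" if x: "x \<in> S" for x
  proof -
    have "independent (insert e I)"
      by (rule independent_mono [OF independent_Basis]) (use e IB in auto)
    then have "e \<notin> span I" using e(2) by (simp add: independent_insert)
    with u(2) [OF x] have "f x \<noteq> 0" by (auto simp: f_def)
    then have "A x (f x) (f x) > 0" using pos x by blast
    moreover have "A x (f x) (f x) = A x (f x) e - A x (f x) (u x)"
      using bilinear_rsub [OF bil [OF x], of "f x" e "u x"] by (simp add: f_def)
    ultimately show ?thesis using orth [OF x u(2) [OF x]] by simp
  qed
  define t where "t x = (\<beta> x e - A x (w x) e) / A x (f x) e" for x
  have Asm: "smooth_on (\<lambda>x. A x (g x) e) S" if "smooth_on g S" for g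
    by (rule smooth_on_bilinear_form [OF S bil smooth that smooth_on_const [OF S]])
  have t: "smooth_on t S"
    unfolding t_def
    by (rule smooth_on_divide [OF S smooth_on_diff [OF S insert.prems(3) Asm [OF w(1)]] Asm [OF f] nz])
      (rule e(1))
  show ?case
  proof (rule exI [of _ "\<lambda>x. w x + t x *\<^sub>R f x"], intro conjI ballI)
    show "smooth_on (\<lambda>x. w x + t x *\<^sub>R f x) S"
      by (intro smooth_on_add smooth_on_scaleR S w(1) t f)
  next
    fix x assume x: "x \<in> S"
    have sub: "span I \<subseteq> span (insert e I)" by (rule span_mono) auto
    show "w x + t x *\<^sub>R f x \<in> span (insert e I)"
      unfolding f_def
      by (intro span_add span_scale span_diff subsetD [OF sub w(2) [OF x]]
          subsetD [OF sub u(2) [OF x]] span_base) simp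
  next
    fix x i assume x: "x \<in> S" and "i \<in> insert e I"
    then consider "i = e" | "i \<in> I" by blast
    then show "A x (w x + t x *\<^sub>R f x) i = \<beta> x i"
    proof cases
      case 1
      then show ?thesis
        using nz [OF x] by (simp add: bilinear_ladd [OF bil [OF x]] bilinear_lmul [OF bil [OF x]] t_def)
    next
      case 2
      then show ?thesis
        using orth [OF x] w(3) [OF x 2]
        by (simp add: bilinear_ladd [OF bil [OF x]] bilinear_lmul [OF bil [OF x]] span_base)
    qed
  qed
qed

lemma smooth_riesz:
  fixes A :: "'v::real_normed_vector \<Rightarrow> 'e::euclidean_space \<Rightarrow> 'e \<Rightarrow> real"
  assumes S: "open S" and bil: "\<And>x. x \<in> S \<Longrightarrow> bilinear (A x)"
    and pos: "\<And>x y. x \<in> S \<Longrightarrow> y \<noteq> 0 \<Longrightarrow> A x y y > 0"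
    and smooth: "\<And>i j. i \<in> Basis \<Longrightarrow> j \<in> Basis \<Longrightarrow> smooth_on (\<lambda>x. A x i j) S"
    and lin: "\<And>x. x \<in> S \<Longrightarrow> linear (\<beta> x)"
    and smooth': "\<And>i. i \<in> Basis \<Longrightarrow> smooth_on (\<lambda>x. \<beta> x i) S"
  obtains w where "smooth_on w S" "\<And>x y. x \<in> S \<Longrightarrow> A x (w x) y = \<beta> x y"
proof -
  obtain w where w: "smooth_on w S" "\<And>x i. x \<in> S \<Longrightarrow> i \<in> Basis \<Longrightarrow> A x (w x) i = \<beta> x i"
    using smooth_riesz_on_span [of S A \<beta> Basis, OF assms] by auto
  have "A x (w x) y = \<beta> x y" if x: "x \<in> S" for x y
  proof -
    have "linear (A x (w x))" using bil [OF x] by (simp add: bilinear_def)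
    from linear_eq_stdbasis [OF this lin [OF x] w(2) [OF x]] show ?thesis by simp
  qed
  with w(1) that show thesis by blast
qed

section \<open>Positivity from strong convexity\<close>

text \<open>Euler's relation, for degree two and second derivatives: differentiate
  \<open>t \<mapsto> f (t y) = t\<^sup>2 f y\<close> twice at \<open>t = 1\<close>.\<close>

lemma euler_second_order:
  fixes f :: "'e::euclidean_space \<Rightarrow> real"
  assumes f: "smooth_on f (UNIV - {0})"
    and hom: "\<And>r. r > 0 \<Longrightarrow> f (r *\<^sub>R y) = r\<^sup>2 * f y"
    and y: "y \<noteq> 0"
  shows "(\<Sum>i\<in>Basis. \<Sum>j\<in>Basis. partial_deriv j (partial_deriv i f) y * (y \<bullet> i) * (y \<bullet> j)) = 2 * f y"
proof -
  have ray: "((\<lambda>t. t *\<^sub>R y) has_derivative (\<lambda>s. s *\<^sub>R y)) (at t)" for t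
    by (auto intro!: derivative_eq_intros)
  define D where "D z = frechet_derivative f (at z)" for z
  have D: "(f has_derivative D z) (at z)" if "z \<noteq> 0" for z
    unfolding D_def using smooth_on_has_derivative [OF f] that by simp
  have first: "D (t *\<^sub>R y) y = 2 * t * f y" if "t > 0" for t
  proof -
    have "((\<lambda>s. f (s *\<^sub>R y)) has_derivative (\<lambda>s. D (t *\<^sub>R y) (s *\<^sub>R y))) (at t)"
      by (rule has_derivative_compose [OF ray D]) (use that y in auto)
    moreover have "((\<lambda>s. f (s *\<^sub>R y)) has_derivative (\<lambda>s. 2 * t * f y * s)) (at t)"
    proof (rule has_derivative_transform_within_open [of "\<lambda>s. s\<^sup>2 * f y" _ _ _ "{0<..}"])
      show "((\<lambda>s. s\<^sup>2 * f y) has_derivative (\<lambda>s. 2 * t * f y * s)) (at t)"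
        by (auto intro!: derivative_eq_intros)
    qed (use that hom in auto)
    ultimately have "(\<lambda>s. D (t *\<^sub>R y) (s *\<^sub>R y)) = (\<lambda>s. 2 * t * f y * s)"
      by (rule has_derivative_unique)
    from fun_cong [OF this, of 1] show ?thesis by simp
  qed
  define E where "E i z = frechet_derivative (partial_deriv i f) (at z)" for i z
  have E: "(partial_deriv i f has_derivative E i z) (at z)" if "z \<noteq> 0" for i z
    unfolding E_def partial_deriv_def
    using smooth_on_has_derivative [OF smooth_on_derivative [OF f]] that by simp
  have expand: "L v = (\<Sum>i\<in>Basis. (v \<bullet> i) * L i)" if "bounded_linear L" for L :: "'e \<Rightarrow> real" and v
    using Linear_Algebra.linear_componentwise [OF bounded_linear.linear [OF that], of v 1] by simp
  have sum1: "(\<Sum>i\<in>Basis. (y \<bullet> i) * partial_deriv i f z) = D z y" if "z \<noteq> 0" for z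
    using expand [OF has_derivative_bounded_linear [OF D [OF that]], of y]
    by (simp add: partial_deriv_def D_def)
  have "((\<lambda>z. \<Sum>i\<in>Basis. (y \<bullet> i) * partial_deriv i f z) has_derivative
      (\<lambda>v. \<Sum>i\<in>Basis. (y \<bullet> i) * E i y v)) (at (1 *\<^sub>R y))"
    using E [OF y] by (auto intro!: derivative_eq_intros)
  from has_derivative_compose [OF ray this]
  have "((\<lambda>t. \<Sum>i\<in>Basis. (y \<bullet> i) * partial_deriv i f (t *\<^sub>R y)) has_derivative
      (\<lambda>s. \<Sum>i\<in>Basis. (y \<bullet> i) * E i y (s *\<^sub>R y))) (at 1)" .
  moreover have "((\<lambda>t. \<Sum>i\<in>Basis. (y \<bullet> i) * partial_deriv i f (t *\<^sub>R y)) has_derivative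
      (\<lambda>s. 2 * f y * s)) (at 1)"
  proof (rule has_derivative_transform_within_open [of "\<lambda>t. 2 * t * f y" _ _ _ "{0<..}"])
    show "((\<lambda>t. 2 * t * f y) has_derivative (\<lambda>s. 2 * f y * s)) (at 1)"
      by (auto intro!: derivative_eq_intros)
  qed (use sum1 first y in auto)
  ultimately have "(\<lambda>s. \<Sum>i\<in>Basis. (y \<bullet> i) * E i y (s *\<^sub>R y)) = (\<lambda>s. 2 * f y * s)"
    by (rule has_derivative_unique)
  from fun_cong [OF this, of 1] have "(\<Sum>i\<in>Basis. (y \<bullet> i) * E i y y) = 2 * f y" by simp
  moreover have "(y \<bullet> i) * E i y y
      = (\<Sum>j\<in>Basis. partial_deriv j (partial_deriv i f) y * (y \<bullet> i) * (y \<bullet> j))" for i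
    using expand [OF has_derivative_bounded_linear [OF E [OF y, of i]], of y]
    by (simp add: partial_deriv_def E_def sum_distrib_left mult_ac)
  ultimately show ?thesis by simp
qed

section \<open>Navigation in a single tangent space\<close>

locale inner_product_on =
  fixes V :: "'v::real_vector set" and g :: "'v \<Rightarrow> 'v \<Rightarrow> real"
  assumes subspace: "subspace V"
    and add_left: "\<lbrakk>u \<in> V; v \<in> V; w \<in> V\<rbrakk> \<Longrightarrow> g (u + v) w = g u w + g v w"
    and scale_left: "\<lbrakk>u \<in> V; w \<in> V\<rbrakk> \<Longrightarrow> g (r *\<^sub>R u) w = r * g u w"
    and sym: "\<lbrakk>u \<in> V; v \<in> V\<rbrakk> \<Longrightarrow> g u v = g v u"
    and pos: "\<lbrakk>v \<in> V; v \<noteq> 0\<rbrakk> \<Longrightarrow> g v v > 0"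
begin

lemmas mem_intros = subspace_add [OF subspace] subspace_scale [OF subspace]
  subspace_diff [OF subspace] subspace_0 [OF subspace] subspace_neg [OF subspace]

lemma add_right: "\<lbrakk>u \<in> V; v \<in> V; w \<in> V\<rbrakk> \<Longrightarrow> g w (u + v) = g w u + g w v"
  using add_left sym by (metis mem_intros(1))

lemma scale_right: "\<lbrakk>u \<in> V; w \<in> V\<rbrakk> \<Longrightarrow> g w (r *\<^sub>R u) = r * g w u"
  using scale_left sym by (metis mem_intros(2))

lemma zero_left: "u \<in> V \<Longrightarrow> g 0 u = 0"
  using scale_left [of u u 0] by simp

lemma nonneg: "v \<in> V \<Longrightarrow> g v v \<ge> 0"
  using pos [of v] zero_left [of v] by (cases "v = 0") auto

lemma square_diff:
  assumes "u \<in> V" "v \<in> V"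
  shows "g (u - v) (u - v) = g u u - 2 * g u v + g v v"
proof -
  have "u - v = u + (- 1) *\<^sub>R v" by simp
  then have "g (u - v) (u - v) = g (u + (- 1) *\<^sub>R v) (u + (- 1) *\<^sub>R v)" by metis
  also have "\<dots> = g u u + (- 1) * g v u + (- 1) * (g u v + (- 1) * g v v)"
    using assms by (simp only: add_left add_right scale_left scale_right mem_intros)
  finally show ?thesis using sym [OF assms] by simp
qed

end

lemma inner_product_on_iff:
  assumes "subspace V"
  shows "inner_product_on V g \<longleftrightarrow>
    (\<forall>u\<in>V. linear_form_on V (\<lambda>v. g u v)) \<and> (\<forall>v\<in>V. linear_form_on V (\<lambda>u. g u v)) \<and>
    (\<forall>u\<in>V. \<forall>v\<in>V. g u v = g v u) \<and> (\<forall>v\<in>V. v \<noteq> 0 \<longrightarrow> g v v > 0)"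
proof
  assume "inner_product_on V g"
  then interpret inner_product_on V g .
  show "(\<forall>u\<in>V. linear_form_on V (\<lambda>v. g u v)) \<and> (\<forall>v\<in>V. linear_form_on V (\<lambda>u. g u v)) \<and>
    (\<forall>u\<in>V. \<forall>v\<in>V. g u v = g v u) \<and> (\<forall>v\<in>V. v \<noteq> 0 \<longrightarrow> g v v > 0)"
    unfolding linear_form_on_def
    by (intro conjI ballI allI impI add_left add_right scale_left scale_right pos sym)
qed (unfold_locales, use assms in \<open>auto simp: linear_form_on_def\<close>)

text \<open>The two parts of the navigation norm \<open>sqrt (zermelo_metric h W v v) + zermelo_form h W v\<close>,
  whose unit sphere is that of \<open>h\<close> translated by \<open>W\<close> when \<open>h W W < 1\<close>.\<close>

definition zermelo_metric :: "('v \<Rightarrow> 'v \<Rightarrow> real) \<Rightarrow> 'v \<Rightarrow> 'v \<Rightarrow> 'v \<Rightarrow> real" where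
  "zermelo_metric h W u v = (h W u * h W v + (1 - h W W) * h u v) / (1 - h W W)\<^sup>2"

definition zermelo_form :: "('v \<Rightarrow> 'v \<Rightarrow> real) \<Rightarrow> 'v \<Rightarrow> 'v \<Rightarrow> real" where
  "zermelo_form h W v = - h W v / (1 - h W W)"

context inner_product_on
begin

lemma zermelo_metric_inner_product_on:
  assumes W: "W \<in> V" "g W W < 1"
  shows "inner_product_on V (zermelo_metric g W)"
proof
  fix v assume v: "v \<in> V" "v \<noteq> 0"
  have "0 < (1 - g W W) * g v v" using W pos [OF v] by simp
  then have "0 < g W v * g W v + (1 - g W W) * g v v"
    by (simp add: add_nonneg_pos)
  then show "zermelo_metric g W v v > 0"
    using W by (simp add: zermelo_metric_def)
qed (use subspace W in \<open>simp_all add: zermelo_metric_def add_left add_right scale_left scale_right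
      sym mult.commute algebra_simps add_divide_distrib [symmetric]\<close>)

lemma zermelo_form_linear:
  assumes W: "W \<in> V" 
  shows "linear_form_on V (zermelo_form g W)"
  using W by (simp add: linear_form_on_def zermelo_form_def add_right scale_right
      add_divide_distrib diff_divide_distrib)

text \<open>The wind is shorter than one, so every ray from the origin meets the translated sphere
  exactly once. At \<open>v\<close> the number \<open>q = F v\<close> is thus the positive root of
  \<open>(1 - g W W) q\<^sup>2 + 2 g W v q = g v v\<close>, which says that \<open>v / q - W\<close> is a unit vector.\<close>

lemma zermelo_formula:
  assumes W: "W \<in> V" "g W W < 1"
    and hom: "\<And>v r. v \<in> V \<Longrightarrow> r > 0 \<Longrightarrow> F (r *\<^sub>R v) = r * F v"
    and sphere: "{v \<in> V. F v = 1} = (\<lambda>u. W + u) ` {u \<in> V. sqrt (g u u) = 1}"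
    and v: "v \<in> V"
  shows "F v = sqrt (zermelo_metric g W v v) + zermelo_form g W v"
proof (cases "v = 0")
  case True
  then have "F v = 0" using hom [OF v, of 2] by simp
  then show ?thesis
    using True zero_left [OF W(1)] sym [OF W(1) mem_intros(4)] zero_left [OF mem_intros(4)]
    by (simp add: zermelo_metric_def zermelo_form_def)
next
  case False
  define l where "l = 1 - g W W"
  define m where "m = g W v"
  define R where "R = sqrt (m\<^sup>2 + l * g v v)"
  define q where "q = (R - m) / l"
  have l: "l > 0" using W by (simp add: l_def)
  have ln: "l * g v v > 0" using l pos [OF v False] by simp
  then have R2: "R\<^sup>2 = m\<^sup>2 + l * g v v" by (simp add: R_def)
  have "\<bar>m\<bar> < R"
    unfolding R_def using ln by (intro real_less_rsqrt) simp
  then have q: "q > 0" unfolding q_def using l by simp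
  have "l * (l * q\<^sup>2 + 2 * m * q - g v v) = (l * q)\<^sup>2 + 2 * m * (l * q) - l * g v v"
    by (simp add: algebra_simps power2_eq_square)
  also have "l * q = R - m" using l by (simp add: q_def)
  also have "(R - m)\<^sup>2 + 2 * m * (R - m) - l * g v v = 0"
    using R2 by (simp add: power2_eq_square algebra_simps)
  finally have root: "g v v = l * q\<^sup>2 + 2 * m * q" using l by simp
  define u where "u = (1 / q) *\<^sub>R v - W"
  have "g u u = (1 / q)\<^sup>2 * g v v - 2 * (1 / q) * g W v + g W W"
    unfolding u_def using v W sym [OF v W(1)]
    by (simp add: square_diff mem_intros scale_left scale_right power2_eq_square)
  also have "\<dots> = 1"
    unfolding root m_def [symmetric] using q
    by (simp add: l_def field_simps power2_eq_square)
  finally have "sqrt (g u u) = 1" by simp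
  moreover have "u \<in> V" unfolding u_def by (intro mem_intros v W)
  ultimately have "W + u \<in> {v \<in> V. F v = 1}" unfolding sphere by blast
  moreover have "W + u = (1 / q) *\<^sub>R v" by (simp add: u_def)
  ultimately have "F ((1 / q) *\<^sub>R v) = 1" by simp
  with hom [OF v, of "1 / q"] q have "F v = q" by (simp add: field_simps)
  moreover have "sqrt (zermelo_metric g W v v) = R / l"
    using l by (simp add: zermelo_metric_def R_def l_def m_def real_sqrt_divide power2_eq_square
        real_sqrt_mult)
  ultimately show ?thesis
    by (simp add: q_def zermelo_form_def l_def m_def diff_divide_distrib)
qed

end

text \<open>The inverse construction: if \<open>B\<close> is the vector dual to \<open>b\<close> and \<open>sqrt a + b\<close> is positive away
  from zero, then translating the unit sphere of \<open>navigation_metric a b B\<close> by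
  \<open>navigation_wind b B\<close> gives that of \<open>sqrt a + b\<close>.\<close>

definition navigation_metric :: "('v \<Rightarrow> 'v \<Rightarrow> real) \<Rightarrow> ('v \<Rightarrow> real) \<Rightarrow> 'v \<Rightarrow> 'v \<Rightarrow> 'v \<Rightarrow> real" where
  "navigation_metric a b B u v = (1 - b B) * (a u v - b u * b v)"

definition navigation_wind :: "('v \<Rightarrow> real) \<Rightarrow> 'v::real_vector \<Rightarrow> 'v" where
  "navigation_wind b B = (- 1 / (1 - b B)) *\<^sub>R B"

text \<open>The number \<open>b B\<close> is the squared norm of the form \<open>b\<close>. That it is less than one follows
  from positivity of \<open>sqrt a + b\<close>.\<close>

locale randers_norm = inner_product_on V a
  for V :: "'v::real_vector set" and a +
  fixes b :: "'v \<Rightarrow> real" and B :: 'v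
  assumes form: "linear_form_on V b"
    and B: "B \<in> V" and dual: "v \<in> V \<Longrightarrow> a B v = b v"
    and positive: "\<lbrakk>v \<in> V; v \<noteq> 0\<rbrakk> \<Longrightarrow> sqrt (a v v) + b v > 0"
begin

lemma b_add: "\<lbrakk>u \<in> V; v \<in> V\<rbrakk> \<Longrightarrow> b (u + v) = b u + b v"
  and b_scale: "v \<in> V \<Longrightarrow> b (r *\<^sub>R v) = r * b v"
  using form by (auto simp: linear_form_on_def)

text \<open>Positivity at \<open>v\<close> and at \<open>- v\<close>.\<close>

lemma abs_form_less:
  assumes "v \<in> V" "v \<noteq> 0"
  shows "\<bar>b v\<bar> < sqrt (a v v)"
proof -
  have "sqrt (a ((- 1) *\<^sub>R v) ((- 1) *\<^sub>R v)) + b ((- 1) *\<^sub>R v) > 0"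
    by (rule positive) (use assms in \<open>auto intro: mem_intros\<close>)
  moreover have "a ((- 1) *\<^sub>R v) ((- 1) *\<^sub>R v) = a v v"
    using assms by (simp only: scale_left scale_right mem_intros)
  ultimately show ?thesis using positive [OF assms] b_scale [OF assms(1), of "- 1"] by simp
qed

lemma form_square_less: "\<lbrakk>v \<in> V; v \<noteq> 0\<rbrakk> \<Longrightarrow> (b v)\<^sup>2 < a v v"
  by (metis abs_form_less abs_ge_zero power2_abs power_strict_mono real_sqrt_pow2
      nonneg zero_less_numeral)

text \<open>At \<open>v = B\<close> the previous inequality is \<open>(b B)\<^sup>2 < b B\<close>.\<close>

lemma norm_form_less_one: "b B < 1"
proof (cases "B = 0")
  case True
  then show ?thesis using dual [OF B] zero_left [OF B] by simp
next
  case False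
  then have "(b B)\<^sup>2 < b B" using form_square_less [OF B] dual [OF B] by simp
  then show ?thesis by (smt (verit) power2_eq_square mult_left_mono mult_cancel_left2)
qed

lemma navigation_metric_inner_product_on: "inner_product_on V (navigation_metric a b B)"
proof
  fix v assume "v \<in> V" "v \<noteq> 0"
  with form_square_less norm_form_less_one show "navigation_metric a b B v v > 0"
    by (simp add: navigation_metric_def power2_eq_square)
qed (use subspace in \<open>simp_all add: navigation_metric_def add_left b_add scale_left b_scale
      sym mult.commute algebra_simps\<close>)

lemma navigation_wind_mem: "navigation_wind b B \<in> V"
  by (simp add: navigation_wind_def mem_intros B)

lemma navigation_metric_wind:
  assumes v: "v \<in> V"
  shows "navigation_metric a b B v (navigation_wind b B) = - (1 - b B) * b v"
proof -
  define r where "r = - 1 / (1 - b B)"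
  have r: "(1 - b B) * r = - 1" using norm_form_less_one by (simp add: r_def)
  have "a v B = b v" using dual [OF v] sym [OF v B] by simp
  then have "navigation_metric a b B v (navigation_wind b B)
      = (1 - b B) * (r * b v - b v * (r * b B))"
    using v B
    by (simp only: navigation_metric_def navigation_wind_def scale_right b_scale r_def [symmetric])
  also have "\<dots> = ((1 - b B) * r) * ((1 - b B) * b v)" by algebra
  finally show ?thesis by (simp only: r)
qed

lemma navigation_wind_norm:
  "navigation_metric a b B (navigation_wind b B) (navigation_wind b B) = b B"
proof -
  have "b (navigation_wind b B) = - b B / (1 - b B)"
    by (simp only: navigation_wind_def b_scale [OF B]) simp
  then have "- (1 - b B) * b (navigation_wind b B) = b B"
    using norm_form_less_one by (simp add: field_simps)
  then show ?thesis by (simp only: navigation_metric_wind [OF navigation_wind_mem])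
qed

text \<open>For both spheres the equation is \<open>a v v = (1 - b v)\<^sup>2\<close>: the sphere of \<open>sqrt a + b\<close>
  adds the condition \<open>b v \<le> 1\<close>, which \<open>\<bar>b v\<bar> \<le> sqrt (a v v) = \<bar>1 - b v\<bar>\<close> implies.\<close>

lemma navigation_sphere:
  "{v \<in> V. sqrt (a v v) + b v = 1} =
     (\<lambda>u. navigation_wind b B + u) ` {u \<in> V. sqrt (navigation_metric a b B u u) = 1}"
proof -
  define h where "h = navigation_metric a b B"
  define W where "W = navigation_wind b B"
  interpret h: inner_product_on V h
    unfolding h_def by (rule navigation_metric_inner_product_on)
  have W: "W \<in> V" unfolding W_def by (rule navigation_wind_mem)
  have e: "1 - b B > 0" using norm_form_less_one by simp
  have equation: "h (v - W) (v - W) = 1 \<longleftrightarrow> a v v = (1 - b v)\<^sup>2" if v: "v \<in> V" for v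
  proof -
    have "h (v - W) (v - W) - 1
        = (1 - b B) * (a v v - b v * b v) + 2 * (1 - b B) * b v + b B - 1"
      using h.square_diff [OF v W] navigation_metric_wind [OF v] navigation_wind_norm
      by (simp add: h_def W_def navigation_metric_def algebra_simps)
    also have "\<dots> = (1 - b B) * (a v v - (1 - b v)\<^sup>2)"
      by (simp add: algebra_simps power2_eq_square)
    finally show ?thesis using e by auto
  qed
  have unit: "sqrt (a v v) + b v = 1 \<longleftrightarrow> a v v = (1 - b v)\<^sup>2" if v: "v \<in> V" for v
  proof
    assume "sqrt (a v v) + b v = 1"
    then have "sqrt (a v v) = 1 - b v" by simp
    then show "a v v = (1 - b v)\<^sup>2" using nonneg [OF v] by (metis real_sqrt_pow2)
  next
    assume *: "a v v = (1 - b v)\<^sup>2"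
    have "\<bar>b v\<bar> \<le> sqrt (a v v)"
    proof (cases "v = 0")
      case True
      then show ?thesis using b_scale [OF v, of 0] nonneg [OF v] by simp
    qed (use abs_form_less v in fastforce)
    moreover have "sqrt (a v v) = \<bar>1 - b v\<bar>" using * by simp
    ultimately show "sqrt (a v v) + b v = 1" by linarith
  qed
  have "v \<in> {v \<in> V. sqrt (a v v) + b v = 1} \<longleftrightarrow> v \<in> (\<lambda>u. W + u) ` {u \<in> V. sqrt (h u u) = 1}" for v
  proof
    assume "v \<in> {v \<in> V. sqrt (a v v) + b v = 1}"
    then have v: "v \<in> V" and "a v v = (1 - b v)\<^sup>2" using unit by auto
    then have "v - W \<in> {u \<in> V. sqrt (h u u) = 1}"
      using equation [OF v] mem_intros(3) [OF v W] by simp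
    then have "W + (v - W) \<in> (\<lambda>u. W + u) ` {u \<in> V. sqrt (h u u) = 1}" by blast
    then show "v \<in> (\<lambda>u. W + u) ` {u \<in> V. sqrt (h u u) = 1}" by simp
  next
    assume "v \<in> (\<lambda>u. W + u) ` {u \<in> V. sqrt (h u u) = 1}"
    then obtain u where u: "v = W + u" "u \<in> V" "sqrt (h u u) = 1" by blast
    then have "v \<in> V" "h (v - W) (v - W) = 1" using W mem_intros(1) by auto
    then show "v \<in> {v \<in> V. sqrt (a v v) + b v = 1}" using equation unit by blast
  qed
  then show ?thesis unfolding h_def W_def by blast
qed

end

section \<open>Tangent spaces and charts\<close>

lemma chart_map_inj:
  assumes "smooth_manifold X \<A>" "c \<in> \<A>"
  shows "inj_on (chart_map c) (chart_dom c)"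
proof -
  have "chart_dom c \<subseteq> topspace X"
    using assms by (auto simp: smooth_manifold_def dest: openin_subset)
  moreover have "homeomorphic_map (subtopology X (chart_dom c)) (top_of_set (chart_image c)) (chart_map c)"
    using assms by (simp add: smooth_manifold_def)
  ultimately show ?thesis
    using homeomorphic_imp_injective_map [of "subtopology X (chart_dom c)"]
    by (metis topspace_subtopology_subset)
qed

lemma chart_inv_chart_map:
  assumes "smooth_manifold X \<A>" "c \<in> \<A>" "p \<in> chart_dom c"
  shows "chart_inv c (chart_map c p) = p"
  unfolding chart_inv_def by (rule inv_into_f_f [OF chart_map_inj [OF assms(1,2)] assms(3)])

lemma chart_inv_props:
  assumes "smooth_manifold X \<A>" "c \<in> \<A>" "x \<in> chart_image c"
  shows chart_inv_mem: "chart_inv c x \<in> chart_dom c"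
    and chart_map_chart_inv: "chart_map c (chart_inv c x) = x"
    and chart_inv_mem_topspace: "chart_inv c x \<in> topspace X"
proof -
  show *: "chart_inv c x \<in> chart_dom c" "chart_map c (chart_inv c x) = x"
    using assms(3) by (auto simp: chart_image_def chart_inv_def inv_into_into f_inv_into_f)
  show "chart_inv c x \<in> topspace X"
    using *(1) assms(1,2) by (auto simp: smooth_manifold_def)
qed

lemma open_chart_image: "\<lbrakk>smooth_manifold X \<A>; c \<in> \<A>\<rbrakk> \<Longrightarrow> open (chart_image c)"
  by (simp add: smooth_manifold_def)

lemma obtain_chart:
  assumes "smooth_manifold X \<A>" "p \<in> topspace X"
  obtains c where "c \<in> \<A>" "p \<in> chart_dom c"
proof -
  have "p \<in> (\<Union>c\<in>\<A>. chart_dom c)" using assms by (simp add: smooth_manifold_def)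
  then show thesis using that by blast
qed

lemma open_chart_overlap:
  assumes "smooth_manifold X \<A>" "c \<in> \<A>" "d \<in> \<A>"
  shows "open (chart_map c ` (chart_dom c \<inter> chart_dom d))"
proof -
  have "homeomorphic_map (subtopology X (chart_dom c)) (top_of_set (chart_image c)) (chart_map c)"
    using assms by (simp add: smooth_manifold_def)
  then have "open_map (subtopology X (chart_dom c)) (top_of_set (chart_image c)) (chart_map c)"
    by (rule homeomorphic_imp_open_map)
  moreover have "openin X (chart_dom d)"
    using assms by (simp add: smooth_manifold_def)
  then have "openin (subtopology X (chart_dom c)) (chart_dom c \<inter> chart_dom d)"
    by (rule openin_subtopology_Int2)
  ultimately have "openin (top_of_set (chart_image c)) (chart_map c ` (chart_dom c \<inter> chart_dom d))"
    by (simp add: open_map_def)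
  then show ?thesis
    using open_chart_image [OF assms(1,2)] openin_open_eq by blast
qed

lemma transition_has_derivative:
  assumes "smooth_manifold X \<A>" "c \<in> charts_at \<A> p" "d \<in> charts_at \<A> p"
  shows "(transition c d has_derivative frechet_derivative (transition c d) (at (chart_map c p)))
    (at (chart_map c p))"
proof (rule smooth_on_has_derivative)
  show "smooth_on (transition c d) (chart_map c ` (chart_dom c \<inter> chart_dom d))"
    using assms by (simp add: smooth_manifold_def charts_at_def)
  show "chart_map c p \<in> chart_map c ` (chart_dom c \<inter> chart_dom d)"
    using assms by (auto simp: charts_at_def)
qed

text \<open>The chain rule for transition maps makes \<^term>\<open>tangent_of\<close> produce tangent vectors.\<close>

lemma transition_cocycle:
  assumes M: "smooth_manifold X \<A>"
    and c: "c \<in> charts_at \<A> p" and d: "d \<in> charts_at \<A> p" and e: "e \<in> charts_at \<A> p"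
  shows "frechet_derivative (transition d e) (at (chart_map d p))
      (frechet_derivative (transition c d) (at (chart_map c p)) y)
    = frechet_derivative (transition c e) (at (chart_map c p)) y"
proof -
  note mem = c [unfolded charts_at_def, simplified] d [unfolded charts_at_def, simplified]
  let ?U = "chart_map c ` (chart_dom c \<inter> chart_dom d)"
  have "transition c d (chart_map c p) = chart_map d p"
    using mem chart_inv_chart_map [OF M] by (simp add: transition_def)
  then have "((\<lambda>x. transition d e (transition c d x)) has_derivative
      (\<lambda>y. frechet_derivative (transition d e) (at (chart_map d p))
        (frechet_derivative (transition c d) (at (chart_map c p)) y))) (at (chart_map c p))"
    using has_derivative_compose [OF transition_has_derivative [OF M c d]]
      transition_has_derivative [OF M d e] by simp
  then have "(transition c e has_derivative
      (\<lambda>y. frechet_derivative (transition d e) (at (chart_map d p))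
        (frechet_derivative (transition c d) (at (chart_map c p)) y))) (at (chart_map c p))"
  proof (rule has_derivative_transform_within_open)
    show "open ?U" using open_chart_overlap [OF M] mem by blast
    show "chart_map c p \<in> ?U" using mem by blast
    fix x assume "x \<in> ?U"
    then obtain q where q: "q \<in> chart_dom c" "q \<in> chart_dom d" "x = chart_map c q" by blast
    then show "transition d e (transition c d x) = transition c e x"
      using mem chart_inv_chart_map [OF M] by (simp add: transition_def)
  qed
  from has_derivative_unique [OF this transition_has_derivative [OF M c e]]
  show ?thesis by (rule fun_cong)
qed

lemma transition_self_derivative:
  assumes M: "smooth_manifold X \<A>" and c: "c \<in> charts_at \<A> p"
  shows "frechet_derivative (transition c c) (at (chart_map c p)) y = y"
proof -
  note mem = c [unfolded charts_at_def, simplified]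
  have "(transition c c has_derivative (\<lambda>y. y)) (at (chart_map c p))"
  proof (rule has_derivative_transform_within_open [OF has_derivative_ident])
    show "open (chart_image c)" using open_chart_image [OF M] mem by blast
    show "chart_map c p \<in> chart_image c" using mem by (auto simp: chart_image_def)
    fix x assume "x \<in> chart_image c"
    then show "x = transition c c x"
      using chart_map_chart_inv [OF M] mem by (simp add: transition_def)
  qed
  from has_derivative_unique [OF transition_has_derivative [OF M c c] this]
  show ?thesis by (rule fun_cong)
qed

lemma tangent_of_mem:
  assumes "smooth_manifold X \<A>" "c \<in> charts_at \<A> p"
  shows "tangent_of \<A> c p y \<in> tangent_space \<A> p"
  using transition_cocycle [OF assms] by (simp add: tangent_space_def tangent_of_def)

lemma tangent_of_component:
  assumes "smooth_manifold X \<A>" "c \<in> charts_at \<A> p"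
  shows "tangent_of \<A> c p y c = y"
  using transition_self_derivative [OF assms] assms(2) by (simp add: tangent_of_def)

lemma tangent_of_self:
  assumes "c \<in> charts_at \<A> p" "v \<in> tangent_space \<A> p"
  shows "tangent_of \<A> c p (v c) = v"
proof
  fix d
  show "tangent_of \<A> c p (v c) d = v d"
    using assms unfolding tangent_space_def tangent_of_def mem_Collect_eq by metis
qed

lemma linear_tangent_of:
  assumes "smooth_manifold X \<A>" "c \<in> charts_at \<A> p"
  shows "linear (tangent_of \<A> c p)"
proof -
  have lin: "linear (frechet_derivative (transition c d) (at (chart_map c p)))"
    if "d \<in> charts_at \<A> p" for d
    using transition_has_derivative [OF assms that] has_derivative_linear by blast
  show ?thesis
  proof (rule linearI)
    show "tangent_of \<A> c p (y + z) = tangent_of \<A> c p y + tangent_of \<A> c p z" for y z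
    proof
      fix d
      show "tangent_of \<A> c p (y + z) d = (tangent_of \<A> c p y + tangent_of \<A> c p z) d"
        using linear_add [OF lin [of d], of y z]
        by (cases "d \<in> charts_at \<A> p") (auto simp: tangent_of_def)
    qed
    show "tangent_of \<A> c p (r *\<^sub>R y) = r *\<^sub>R tangent_of \<A> c p y" for r y
    proof
      fix d
      show "tangent_of \<A> c p (r *\<^sub>R y) d = (r *\<^sub>R tangent_of \<A> c p y) d"
        using linear_cmul [OF lin [of d], of r y]
        by (cases "d \<in> charts_at \<A> p") (auto simp: tangent_of_def scaleR_fun_def)
    qed
  qed
qed

lemma subspace_tangent_space:
  fixes \<A> :: "('a, 'e::euclidean_space) chart set"
  assumes M: "smooth_manifold X \<A>" and p: "p \<in> topspace X"
  shows "subspace (tangent_space \<A> p)"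
proof -
  obtain c where "c \<in> \<A>" "p \<in> chart_dom c" using obtain_chart [OF M p] .
  then have c: "c \<in> charts_at \<A> p" by (simp add: charts_at_def)
  have "v \<in> range (tangent_of \<A> c p)" if "v \<in> tangent_space \<A> p" for v
    using tangent_of_self [OF c that] by (metis rangeI)
  then have "tangent_space \<A> p = range (tangent_of \<A> c p)"
    using tangent_of_mem [OF M c] by blast
  then show ?thesis
    using linear_subspace_image [OF linear_tangent_of [OF M c] subspace_UNIV] by simp
qed

section \<open>Smooth tensor fields\<close>

lemma riemannian_metric_iff:
  assumes "smooth_manifold X \<A>"
  shows "riemannian_metric X \<A> a \<longleftrightarrow>
    (\<forall>p\<in>topspace X. inner_product_on (tangent_space \<A> p) (a p)) \<and>
    (\<forall>c\<in>\<A>. \<forall>i\<in>Basis. \<forall>j\<in>Basis. smooth_on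
        (\<lambda>x. a (chart_inv c x) (tangent_of \<A> c (chart_inv c x) i)
                (tangent_of \<A> c (chart_inv c x) j)) (chart_image c))"
  unfolding riemannian_metric_def
  by (simp add: inner_product_on_iff [OF subspace_tangent_space [OF assms]] cong: ball_cong)

lemma riemannian_metric_inner_product_on:
  "\<lbrakk>smooth_manifold X \<A>; riemannian_metric X \<A> a; p \<in> topspace X\<rbrakk>
    \<Longrightarrow> inner_product_on (tangent_space \<A> p) (a p)"
  by (simp add: riemannian_metric_iff)

lemma chart_inv_charts_at:
  "\<lbrakk>smooth_manifold X \<A>; c \<in> \<A>; x \<in> chart_image c\<rbrakk> \<Longrightarrow> c \<in> charts_at \<A> (chart_inv c x)"
  using chart_inv_mem by (simp add: charts_at_def)

lemma linear_tangent_form: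
  assumes "smooth_manifold X \<A>" "c \<in> charts_at \<A> p" "linear_form_on (tangent_space \<A> p) f"
  shows "linear (\<lambda>y. f (tangent_of \<A> c p y))"
  using tangent_of_mem [OF assms(1,2)] assms(3)
  by (intro linearI)
    (simp_all add: linear_form_on_def linear_add [OF linear_tangent_of [OF assms(1,2)]]
      linear_cmul [OF linear_tangent_of [OF assms(1,2)]])

lemma bilinear_tangent_metric:
  assumes "smooth_manifold X \<A>" "c \<in> charts_at \<A> p" "inner_product_on (tangent_space \<A> p) g"
  shows "bilinear (\<lambda>y z. g (tangent_of \<A> c p y) (tangent_of \<A> c p z))"
proof -
  interpret inner_product_on "tangent_space \<A> p" g by fact
  have "\<And>v. v \<in> tangent_space \<A> p \<Longrightarrow> linear_form_on (tangent_space \<A> p) (\<lambda>u. g u v)"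
    "\<And>v. v \<in> tangent_space \<A> p \<Longrightarrow> linear_form_on (tangent_space \<A> p) (g v)"
    by (simp_all add: linear_form_on_def add_left add_right scale_left scale_right)
  with tangent_of_mem [OF assms(1,2)] show ?thesis
    unfolding bilinear_def by (intro conjI allI linear_tangent_form [OF assms(1,2)]) blast+
qed

text \<open>A common frame for the coordinate fields, which exist only on the domain of one chart, and
  for the restrictions of vector fields on the whole manifold: the smoothness of all coefficients
  below is a matter of contracting tensors with these two kinds of fields.\<close>

definition smooth_section ::
    "('a, 'e::euclidean_space) chart set \<Rightarrow> ('a, 'e) chart \<Rightarrow> ('e \<Rightarrow> ('a, 'e) tvec) \<Rightarrow> bool" where
  "smooth_section \<A> c s \<longleftrightarrow>
     (\<forall>x\<in>chart_image c. s x \<in> tangent_space \<A> (chart_inv c x)) \<and>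
     smooth_on (\<lambda>x. s x c) (chart_image c)"

lemma smooth_section_basis:
  assumes "smooth_manifold X \<A>" "c \<in> \<A>"
  shows "smooth_section \<A> c (\<lambda>x. tangent_of \<A> c (chart_inv c x) y)"
proof -
  note at = chart_inv_charts_at [OF assms]
  have "smooth_on (\<lambda>x. tangent_of \<A> c (chart_inv c x) y c) (chart_image c)"
    by (rule smooth_on_cong [OF open_chart_image [OF assms]
          smooth_on_const [OF open_chart_image [OF assms], of y]])
      (rule tangent_of_component [OF assms(1) at])
  then show ?thesis
    using tangent_of_mem [OF assms(1) at] by (simp add: smooth_section_def)
qed

lemma smooth_section_vector_field:
  assumes "smooth_manifold X \<A>" "c \<in> \<A>" "vector_field X \<A> W"
  shows "smooth_section \<A> c (\<lambda>x. W (chart_inv c x))"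
  using assms chart_inv_mem_topspace [OF assms(1,2)]
  by (simp add: smooth_section_def vector_field_def)

lemma smooth_on_metric_sections:
  assumes M: "smooth_manifold X \<A>" and c: "c \<in> \<A>" and g: "riemannian_metric X \<A> g"
    and s: "smooth_section \<A> c s" and t: "smooth_section \<A> c t"
  shows "smooth_on (\<lambda>x. g (chart_inv c x) (s x) (t x)) (chart_image c)"
proof -
  note op = open_chart_image [OF M c]
  let ?A = "\<lambda>x y z. g (chart_inv c x) (tangent_of \<A> c (chart_inv c x) y) (tangent_of \<A> c (chart_inv c x) z)"
  have "smooth_on (\<lambda>x. ?A x (s x c) (t x c)) (chart_image c)"
  proof (rule smooth_on_bilinear_form [where A = ?A, OF op])
    show "bilinear (?A x)" if "x \<in> chart_image c" for x
      using that by (intro bilinear_tangent_metric [OF M] chart_inv_charts_at [OF M c]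
          riemannian_metric_inner_product_on [OF M g] chart_inv_mem_topspace [OF M c])
    show "smooth_on (\<lambda>x. ?A x i j) (chart_image c)" if "i \<in> Basis" "j \<in> Basis" for i j
      using g c that by (simp add: riemannian_metric_def)
  qed (use s t in \<open>simp_all add: smooth_section_def\<close>)
  then show ?thesis
  proof (rule smooth_on_cong [OF op])
    fix x assume x: "x \<in> chart_image c"
    show "g (chart_inv c x) (s x) (t x) = ?A x (s x c) (t x c)"
      using tangent_of_self [OF chart_inv_charts_at [OF M c x]] s t x
      by (simp add: smooth_section_def)
  qed
qed

lemma smooth_on_form_section:
  assumes M: "smooth_manifold X \<A>" and c: "c \<in> \<A>" and b: "one_form X \<A> b"
    and s: "smooth_section \<A> c s"
  shows "smooth_on (\<lambda>x. b (chart_inv c x) (s x)) (chart_image c)"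
proof -
  note op = open_chart_image [OF M c]
  let ?\<beta> = "\<lambda>x y. b (chart_inv c x) (tangent_of \<A> c (chart_inv c x) y)"
  have "smooth_on (\<lambda>x. ?\<beta> x (s x c)) (chart_image c)"
  proof (rule smooth_on_linear_form [where \<beta> = ?\<beta>, OF op])
    show "linear (?\<beta> x)" if "x \<in> chart_image c" for x
      using b chart_inv_mem_topspace [OF M c that]
      by (intro linear_tangent_form [OF M chart_inv_charts_at [OF M c that]])
        (simp add: one_form_def)
    show "smooth_on (\<lambda>x. ?\<beta> x i) (chart_image c)" if "i \<in> Basis" for i
      using b c that by (simp add: one_form_def)
  qed (use s in \<open>simp add: smooth_section_def\<close>)
  then show ?thesis
  proof (rule smooth_on_cong [OF op])
    fix x assume x: "x \<in> chart_image c"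
    show "b (chart_inv c x) (s x) = ?\<beta> x (s x c)"
      using tangent_of_self [OF chart_inv_charts_at [OF M c x]] s x
      by (simp add: smooth_section_def)
  qed
qed

text \<open>In each chart \<open>smooth_riesz\<close> gives a smooth dual field. A dual vector at a point is unique
  because the metric is definite, hence the local fields agree and \<open>B\<close> can be chosen pointwise.\<close>

lemma one_form_dual_vector_field:
  assumes M: "smooth_manifold X \<A>" and a: "riemannian_metric X \<A> a" and b: "one_form X \<A> b"
  obtains B where "vector_field X \<A> B"
    "\<And>p v. p \<in> topspace X \<Longrightarrow> v \<in> tangent_space \<A> p \<Longrightarrow> a p (B p) v = b p v"
proof -
  have local: "\<exists>w. smooth_on w (chart_image c) \<and> (\<forall>x\<in>chart_image c. \<forall>v\<in>tangent_space \<A> (chart_inv c x).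
      a (chart_inv c x) (tangent_of \<A> c (chart_inv c x) (w x)) v = b (chart_inv c x) v)"
    if c: "c \<in> \<A>" for c
  proof -
    let ?T = "\<lambda>x. tangent_of \<A> c (chart_inv c x)"
    have at: "c \<in> charts_at \<A> (chart_inv c x)"
      and inner: "inner_product_on (tangent_space \<A> (chart_inv c x)) (a (chart_inv c x))"
      if "x \<in> chart_image c" for x
      by (rule chart_inv_charts_at [OF M c that],
          rule riemannian_metric_inner_product_on [OF M a chart_inv_mem_topspace [OF M c that]])
    obtain w where w: "smooth_on w (chart_image c)"
      "\<And>x y. x \<in> chart_image c \<Longrightarrow> a (chart_inv c x) (?T x (w x)) (?T x y) = b (chart_inv c x) (?T x y)"
    proof (rule smooth_riesz [OF open_chart_image [OF M c],
          of "\<lambda>x y z. a (chart_inv c x) (?T x y) (?T x z)" "\<lambda>x y. b (chart_inv c x) (?T x y)"])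
      fix x assume x: "x \<in> chart_image c"
      show "bilinear (\<lambda>y z. a (chart_inv c x) (?T x y) (?T x z))"
        by (rule bilinear_tangent_metric [OF M at [OF x] inner [OF x]])
      show "linear (\<lambda>y. b (chart_inv c x) (?T x y))"
        using b chart_inv_mem_topspace [OF M c x]
        by (intro linear_tangent_form [OF M at [OF x]]) (simp add: one_form_def)
      fix y :: 'b assume "y \<noteq> 0"
      then have "?T x y \<noteq> 0"
        using tangent_of_component [OF M at [OF x], of y] by (metis zero_fun_apply)
      then show "a (chart_inv c x) (?T x y) (?T x y) > 0"
        using inner_product_on.pos [OF inner [OF x]] tangent_of_mem [OF M at [OF x]] by blast
    next
      show "smooth_on (\<lambda>x. a (chart_inv c x) (?T x i) (?T x j)) (chart_image c)"
        if "i \<in> Basis" "j \<in> Basis" for i j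
        using a c that by (simp add: riemannian_metric_def)
      show "smooth_on (\<lambda>x. b (chart_inv c x) (?T x i)) (chart_image c)" if "i \<in> Basis" for i
        using b c that by (simp add: one_form_def)
    qed blast
    have "a (chart_inv c x) (?T x (w x)) v = b (chart_inv c x) v"
      if "x \<in> chart_image c" "v \<in> tangent_space \<A> (chart_inv c x)" for x v
      using w(2) [OF that(1), of "v c"] tangent_of_self [OF at [OF that(1)] that(2)] by simp
    with w(1) show ?thesis by blast
  qed
  define dual where "dual p u \<longleftrightarrow> u \<in> tangent_space \<A> p \<and> (\<forall>v\<in>tangent_space \<A> p. a p u v = b p v)" for p u
  have unique: "u = u'" if p: "p \<in> topspace X" and "dual p u" "dual p u'" for p u u'
  proof (rule ccontr)
    assume "u \<noteq> u'"
    interpret inner_product_on "tangent_space \<A> p" "a p"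
      by (rule riemannian_metric_inner_product_on [OF M a p])
    have u: "u \<in> tangent_space \<A> p" "u' \<in> tangent_space \<A> p" using that by (auto simp: dual_def)
    have "a p u v = a p u' v" if "v \<in> tangent_space \<A> p" for v
      using that \<open>dual p u\<close> \<open>dual p u'\<close> by (simp add: dual_def)
    then have "a p (u - u') (u - u') = 0"
      using u by (simp add: square_diff sym)
    then show False using pos [of "u - u'"] u \<open>u \<noteq> u'\<close> by (simp add: mem_intros)
  qed
  define B where "B p = (SOME u. dual p u)" for p
  have in_chart: "dual (chart_inv c x) (tangent_of \<A> c (chart_inv c x) (w x))"
    if "c \<in> \<A>" "x \<in> chart_image c"
      "\<forall>x\<in>chart_image c. \<forall>v\<in>tangent_space \<A> (chart_inv c x).
        a (chart_inv c x) (tangent_of \<A> c (chart_inv c x) (w x)) v = b (chart_inv c x) v" for c x w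
    using that tangent_of_mem [OF M chart_inv_charts_at [OF M that(1,2)]] by (simp add: dual_def)
  have B: "dual p (B p)" if p: "p \<in> topspace X" for p
  proof -
    obtain c where c: "c \<in> \<A>" "p \<in> chart_dom c" using obtain_chart [OF M p] .
    then have "chart_map c p \<in> chart_image c" "chart_inv c (chart_map c p) = p"
      using chart_inv_chart_map [OF M] by (auto simp: chart_image_def)
    then have "\<exists>u. dual p u" using local [OF c(1)] in_chart [OF c(1)] by metis
    then show ?thesis unfolding B_def by (rule someI_ex)
  qed
  have "vector_field X \<A> B"
    unfolding vector_field_def
  proof (intro conjI ballI)
    show "B p \<in> tangent_space \<A> p" if "p \<in> topspace X" for p
      using B [OF that] by (simp add: dual_def)
    fix c assume c: "c \<in> \<A>"
    from local [OF c] obtain w where w: "smooth_on w (chart_image c)"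
      "\<forall>x\<in>chart_image c. \<forall>v\<in>tangent_space \<A> (chart_inv c x).
        a (chart_inv c x) (tangent_of \<A> c (chart_inv c x) (w x)) v = b (chart_inv c x) v" by blast
    show "smooth_on (\<lambda>x. B (chart_inv c x) c) (chart_image c)"
    proof (rule smooth_on_cong [OF open_chart_image [OF M c] w(1)])
      fix x assume x: "x \<in> chart_image c"
      have "B (chart_inv c x) = tangent_of \<A> c (chart_inv c x) (w x)"
        by (rule unique [OF _ B in_chart [OF c x w(2)]]) (rule chart_inv_mem_topspace [OF M c x])+
      then show "B (chart_inv c x) c = w x"
        using tangent_of_component [OF M chart_inv_charts_at [OF M c x]] by simp
    qed
  qed
  with B that show thesis unfolding dual_def by blast
qed

section \<open>Randers metrics and navigation\<close>

text \<open>By Euler's relation the fundamental form at \<open>v\<close>, evaluated on \<open>v\<close> itself, is \<open>(F v)\<^sup>2\<close>;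
  strong convexity makes it positive.\<close>

lemma strongly_convex_pos:
  assumes M: "smooth_manifold X \<A>" and F: "finsler_metric X \<A> F" and sc: "strongly_convex \<A> F"
    and p: "p \<in> topspace X" and v: "v \<in> tangent_space \<A> p" "v \<noteq> 0"
  shows "F p v > 0"
proof -
  obtain c where c: "c \<in> \<A>" "p \<in> chart_dom c" using obtain_chart [OF M p] .
  then have at: "c \<in> charts_at \<A> p" by (simp add: charts_at_def)
  define y where "y = v c"
  have vy: "tangent_of \<A> c p y = v" unfolding y_def by (rule tangent_of_self [OF at v(1)])
  have lin: "linear (tangent_of \<A> c p)" by (rule linear_tangent_of [OF M at])
  have y: "y \<noteq> 0" using vy v(2) linear_0 [OF lin] by metis
  define f where "f z = (F p (tangent_of \<A> c p z))\<^sup>2" for z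
  have "smooth_on (\<lambda>(x, y). F (chart_inv c x) (tangent_of \<A> c (chart_inv c x) y))
      (chart_image c \<times> (UNIV - {0}))"
    using F c by (simp add: finsler_metric_def)
  then have "smooth_on (\<lambda>z. F p (tangent_of \<A> c p z)) (UNIV - {0})"
    using smooth_on_slice [of "UNIV - {0}" "chart_map c p" "chart_image c"] c
      chart_inv_chart_map [OF M c] by (fastforce simp: chart_image_def open_delete)
  then have "smooth_on f (UNIV - {0})"
    unfolding f_def power2_eq_square by (intro smooth_on_mult) (auto simp: open_delete)
  moreover have "f (r *\<^sub>R y) = r\<^sup>2 * f y" if "r > 0" for r
    using F p v(1) that vy
    by (simp add: f_def finsler_metric_def linear_cmul [OF lin] power_mult_distrib)
  ultimately have "(\<Sum>i\<in>Basis. \<Sum>j\<in>Basis. partial_deriv j (partial_deriv i f) y * (y \<bullet> i) * (y \<bullet> j))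
      = 2 * f y"
    using y by (intro euler_second_order)
  moreover have "0 < (\<Sum>i\<in>Basis. \<Sum>j\<in>Basis. fundamental_matrix \<A> F c p y i j * (y \<bullet> i) * (y \<bullet> j))"
    using sc c y by (simp add: strongly_convex_def)
  moreover have "(\<Sum>i\<in>Basis. \<Sum>j\<in>Basis. fundamental_matrix \<A> F c p y i j * (y \<bullet> i) * (y \<bullet> j))
      = 1 / 2 * (\<Sum>i\<in>Basis. \<Sum>j\<in>Basis. partial_deriv j (partial_deriv i f) y * (y \<bullet> i) * (y \<bullet> j))"
    by (simp add: fundamental_matrix_def f_def [abs_def] sum_distrib_left mult.assoc)
  ultimately have "f y > 0" by simp
  then have "F p v \<noteq> 0" by (auto simp: f_def vy)
  moreover have "F p v \<ge> 0" using F p v(1) by (simp add: finsler_metric_def)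
  ultimately show ?thesis by simp
qed

lemma solves_zermelo_formula:
  assumes M: "smooth_manifold X \<A>" and F: "finsler_metric X \<A> F"
    and h: "riemannian_metric X \<A> h" and W: "wind X \<A> h W" and Z: "solves_zermelo X \<A> h W F"
    and p: "p \<in> topspace X" and v: "v \<in> tangent_space \<A> p"
  shows "F p v = sqrt (zermelo_metric (h p) (W p) v v) + zermelo_form (h p) (W p) v"
proof (rule inner_product_on.zermelo_formula [OF riemannian_metric_inner_product_on [OF M h p]])
  show "W p \<in> tangent_space \<A> p" "h p (W p) (W p) < 1"
    using W p by (simp_all add: wind_def vector_field_def)
  show "F p (r *\<^sub>R v) = r * F p v" if "v \<in> tangent_space \<A> p" "r > 0" for v r
    using F p that by (simp add: finsler_metric_def)
  show "{v \<in> tangent_space \<A> p. F p v = 1} =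
      (\<lambda>u. W p + u) ` {u \<in> tangent_space \<A> p. sqrt (h p u u) = 1}"
    using Z p unfolding solves_zermelo_def by blast
qed (rule v)

lemma solves_zermelo_imp_randers_type:
  assumes M: "smooth_manifold X \<A>" and F: "finsler_metric X \<A> F"
    and h: "riemannian_metric X \<A> h" and W: "wind X \<A> h W" and Z: "solves_zermelo X \<A> h W F"
  shows "randers_type X \<A> F"
proof -
  define a where "a p = zermelo_metric (h p) (W p)" for p
  define b where "b p = zermelo_form (h p) (W p)" for p
  have Wf: "vector_field X \<A> W" using W by (simp add: wind_def)
  have Wp: "W p \<in> tangent_space \<A> p" "h p (W p) (W p) < 1" if "p \<in> topspace X" for p
    using W that by (simp_all add: wind_def vector_field_def)
  note inner = riemannian_metric_inner_product_on [OF M h]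
  \<comment> \<open>The quotients below are smooth because the wind is strictly shorter than one.\<close>
  have nz: "1 - h (chart_inv c x) (W (chart_inv c x)) (W (chart_inv c x)) \<noteq> 0"
    "(1 - h (chart_inv c x) (W (chart_inv c x)) (W (chart_inv c x)))\<^sup>2 \<noteq> 0"
    if "c \<in> \<A>" "x \<in> chart_image c" for c x
    using Wp(2) [OF chart_inv_mem_topspace [OF M that]] by auto
  have "riemannian_metric X \<A> a"
    unfolding riemannian_metric_iff [OF M]
  proof (intro conjI ballI)
    show "inner_product_on (tangent_space \<A> p) (a p)" if "p \<in> topspace X" for p
      unfolding a_def
      by (rule inner_product_on.zermelo_metric_inner_product_on) (rule inner Wp that)+
    fix c and i j :: 'b assume c: "c \<in> \<A>"
    note op = open_chart_image [OF M c]
    note basis = smooth_section_basis [OF M c]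
    note wind = smooth_section_vector_field [OF M c Wf]
    note sm = smooth_on_metric_sections [OF M c h]
    note lam = smooth_on_diff [OF op smooth_on_const [OF op] sm [OF wind wind], of 1]
    show "smooth_on (\<lambda>x. a (chart_inv c x) (tangent_of \<A> c (chart_inv c x) i)
        (tangent_of \<A> c (chart_inv c x) j)) (chart_image c)"
      unfolding a_def zermelo_metric_def power2_eq_square
      by (rule smooth_on_divide [OF op
            smooth_on_add [OF op smooth_on_mult [OF op sm [OF wind basis] sm [OF wind basis]]
              smooth_on_mult [OF op lam sm [OF basis basis]]]
            smooth_on_mult [OF op lam lam]])
        (use nz [OF c] in simp)
  qed
  moreover have "one_form X \<A> b"
    unfolding one_form_def
  proof (intro conjI ballI)
    show "linear_form_on (tangent_space \<A> p) (b p)" if "p \<in> topspace X" for p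
      unfolding b_def
      by (rule inner_product_on.zermelo_form_linear [OF inner [OF that] Wp(1) [OF that]])
    fix c and i :: 'b assume c: "c \<in> \<A>"
    note op = open_chart_image [OF M c]
    note basis = smooth_section_basis [OF M c]
    note wind = smooth_section_vector_field [OF M c Wf]
    note sm = smooth_on_metric_sections [OF M c h]
    show "smooth_on (\<lambda>x. b (chart_inv c x) (tangent_of \<A> c (chart_inv c x) i)) (chart_image c)"
      unfolding b_def zermelo_form_def
      by (rule smooth_on_divide [OF op smooth_on_minus [OF op sm [OF wind basis]]
            smooth_on_diff [OF op smooth_on_const [OF op] sm [OF wind wind]] nz(1) [OF c]])
  qed
  moreover have "F p v = sqrt (a p v v) + b p v" if "p \<in> topspace X" "v \<in> tangent_space \<A> p" for p v
    unfolding a_def b_def by (rule solves_zermelo_formula [OF M F h W Z that])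
  ultimately show ?thesis unfolding randers_type_def by blast
qed

lemma randers_type_imp_solves_zermelo:
  assumes M: "smooth_manifold X \<A>" and R: "randers_type X \<A> F"
    and positive: "\<And>p v. p \<in> topspace X \<Longrightarrow> v \<in> tangent_space \<A> p \<Longrightarrow> v \<noteq> 0 \<Longrightarrow> F p v > 0"
  shows "\<exists>h W. riemannian_metric X \<A> h \<and> wind X \<A> h W \<and> solves_zermelo X \<A> h W F"
proof -
  obtain a b where a: "riemannian_metric X \<A> a" and b: "one_form X \<A> b"
    and F: "\<And>p v. p \<in> topspace X \<Longrightarrow> v \<in> tangent_space \<A> p \<Longrightarrow> F p v = sqrt (a p v v) + b p v"
    using R unfolding randers_type_def by blast
  obtain B where B: "vector_field X \<A> B"
    and dual: "\<And>p v. p \<in> topspace X \<Longrightarrow> v \<in> tangent_space \<A> p \<Longrightarrow> a p (B p) v = b p v"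
    using one_form_dual_vector_field [OF M a b] by blast
  define h where "h p = navigation_metric (a p) (b p) (B p)" for p
  define W where "W p = navigation_wind (b p) (B p)" for p
  have norm: "randers_norm (tangent_space \<A> p) (a p) (b p) (B p)" if p: "p \<in> topspace X" for p
  proof -
    interpret inner_product_on "tangent_space \<A> p" "a p"
      by (rule riemannian_metric_inner_product_on [OF M a p])
    show ?thesis
      by unfold_locales
        (use p b B dual [OF p] positive [OF p] F [OF p] in \<open>auto simp: one_form_def vector_field_def\<close>)
  qed
  have less: "b p (B p) < 1" if "p \<in> topspace X" for p
    by (rule randers_norm.norm_form_less_one [OF norm [OF that]])
  have "riemannian_metric X \<A> h"
    unfolding riemannian_metric_iff [OF M]
  proof (intro conjI ballI)
    show "inner_product_on (tangent_space \<A> p) (h p)" if "p \<in> topspace X" for p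
      unfolding h_def by (rule randers_norm.navigation_metric_inner_product_on [OF norm [OF that]])
    fix c and i j :: 'b assume c: "c \<in> \<A>"
    note op = open_chart_image [OF M c]
    note basis = smooth_section_basis [OF M c]
    note form = smooth_on_form_section [OF M c b]
    show "smooth_on (\<lambda>x. h (chart_inv c x) (tangent_of \<A> c (chart_inv c x) i)
        (tangent_of \<A> c (chart_inv c x) j)) (chart_image c)"
      unfolding h_def navigation_metric_def
      by (rule smooth_on_mult [OF op
            smooth_on_diff [OF op smooth_on_const [OF op] form [OF smooth_section_vector_field [OF M c B]]]
            smooth_on_diff [OF op smooth_on_metric_sections [OF M c a basis basis]
              smooth_on_mult [OF op form [OF basis] form [OF basis]]]])
  qed
  moreover have "wind X \<A> h W"
    unfolding wind_def vector_field_def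
  proof (intro conjI ballI)
    fix p assume p: "p \<in> topspace X"
    show "W p \<in> tangent_space \<A> p"
      unfolding W_def by (rule randers_norm.navigation_wind_mem [OF norm [OF p]])
    show "h p (W p) (W p) < 1"
      unfolding W_def h_def randers_norm.navigation_wind_norm [OF norm [OF p]] by (rule less [OF p])
  next
    fix c assume c: "c \<in> \<A>"
    note op = open_chart_image [OF M c]
    have nz: "1 - b (chart_inv c x) (B (chart_inv c x)) \<noteq> 0" if "x \<in> chart_image c" for x
      using less [OF chart_inv_mem_topspace [OF M c that]] by simp
    have "smooth_on (\<lambda>x. B (chart_inv c x) c) (chart_image c)"
      using B c by (simp add: vector_field_def)
    from smooth_on_scaleR [OF op smooth_on_divide [OF op smooth_on_const [OF op]
          smooth_on_diff [OF op smooth_on_const [OF op]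
            smooth_on_form_section [OF M c b smooth_section_vector_field [OF M c B]]] nz] this]
    show "smooth_on (\<lambda>x. W (chart_inv c x) c) (chart_image c)"
      unfolding W_def navigation_wind_def scaleR_fun_def .
  qed
  moreover have "solves_zermelo X \<A> h W F"
    unfolding solves_zermelo_def
  proof
    fix p assume p: "p \<in> topspace X"
    have "{v \<in> tangent_space \<A> p. F p v = 1} = {v \<in> tangent_space \<A> p. sqrt (a p v v) + b p v = 1}"
      using F [OF p] by auto
    also have "\<dots> = (\<lambda>u. W p + u) ` {u \<in> tangent_space \<A> p. sqrt (h p u u) = 1}"
      unfolding W_def h_def by (rule randers_norm.navigation_sphere [OF norm [OF p]])
    finally show "{v \<in> tangent_space \<A> p. F p v = 1} =
        (\<lambda>u. W p + u) ` {u \<in> tangent_space \<A> p. sqrt (h p u u) = 1}" .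
  qed
  ultimately show ?thesis by blast
qed

text \<open>A Riemannian norm is reversible, whereas the values of the navigation norm at \<open>W\<close> and \<open>- W\<close>
  differ by \<open>2 h(W, W) / (1 - h(W, W))\<close>.\<close>

lemma riemannian_type_iff_no_wind:
  assumes M: "smooth_manifold X \<A>" and F: "finsler_metric X \<A> F"
    and h: "riemannian_metric X \<A> h" and W: "wind X \<A> h W" and Z: "solves_zermelo X \<A> h W F"
  shows "riemannian_type X \<A> F \<longleftrightarrow> (\<forall>p\<in>topspace X. W p = 0)"
proof
  assume "riemannian_type X \<A> F"
  then obtain a where a: "riemannian_metric X \<A> a"
    and Fa: "\<And>p v. p \<in> topspace X \<Longrightarrow> v \<in> tangent_space \<A> p \<Longrightarrow> F p v = sqrt (a p v v)"
    unfolding riemannian_type_def by blast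
  show "\<forall>p\<in>topspace X. W p = 0"
  proof (rule ballI, rule ccontr)
    fix p assume p: "p \<in> topspace X" and nz: "W p \<noteq> 0"
    define w where "w = W p"
    interpret h: inner_product_on "tangent_space \<A> p" "h p"
      by (rule riemannian_metric_inner_product_on [OF M h p])
    interpret a: inner_product_on "tangent_space \<A> p" "a p"
      by (rule riemannian_metric_inner_product_on [OF M a p])
    have w: "w \<in> tangent_space \<A> p" and lam: "h p w w < 1"
      using W p by (simp_all add: wind_def vector_field_def w_def)
    have mw: "(- 1) *\<^sub>R w \<in> tangent_space \<A> p" by (rule h.mem_intros(2) [OF w])
    note formula = solves_zermelo_formula [OF M F h W Z p, folded w_def]
    have "zermelo_metric (h p) w ((- 1) *\<^sub>R w) ((- 1) *\<^sub>R w) = zermelo_metric (h p) w w w"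
      by (simp only: zermelo_metric_def h.scale_left h.scale_right w mw) simp
    moreover have "zermelo_form (h p) w ((- 1) *\<^sub>R w) = - zermelo_form (h p) w w"
      by (simp only: zermelo_form_def h.scale_right w)
    moreover have "F p ((- 1) *\<^sub>R w) = F p w"
      by (simp only: Fa p w mw a.scale_left a.scale_right) simp
    ultimately have "zermelo_form (h p) w w = 0"
      using formula [OF w] formula [OF mw] by simp
    then have "h p w w = 0" using lam by (simp add: zermelo_form_def)
    then show False using h.pos [OF w] nz by (simp add: w_def)
  qed
next
  assume W0: "\<forall>p\<in>topspace X. W p = 0"
  have "F p v = sqrt (h p v v)" if p: "p \<in> topspace X" and v: "v \<in> tangent_space \<A> p" for p v
  proof -
    interpret inner_product_on "tangent_space \<A> p" "h p"
      by (rule riemannian_metric_inner_product_on [OF M h p])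
    show ?thesis
      using solves_zermelo_formula [OF M F h W Z p v] W0 p zero_left [OF v] zero_left [OF mem_intros(4)]
      by (simp add: zermelo_metric_def zermelo_form_def)
  qed
  with h show "riemannian_type X \<A> F" unfolding riemannian_type_def by blast
qed

theorem proposition1:
  fixes X :: "'a topology"
    and \<A> :: "('a, 'e::euclidean_space) chart set"
    and F :: "'a \<Rightarrow> ('a, 'e) tvec \<Rightarrow> real"
  assumes "smooth_manifold X \<A>"
    and "finsler_metric X \<A> F"
    and "strongly_convex \<A> F"
  shows "(randers_type X \<A> F \<longleftrightarrow>
           (\<exists>h W. riemannian_metric X \<A> h \<and> wind X \<A> h W \<and> solves_zermelo X \<A> h W F)) \<and>
         (\<forall>h W. riemannian_metric X \<A> h \<and> wind X \<A> h W \<and> solves_zermelo X \<A> h W F \<longrightarrow>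
           (riemannian_type X \<A> F \<longleftrightarrow> (\<forall>p\<in>topspace X. W p = 0)))"
proof (intro conjI allI impI)
  show "randers_type X \<A> F \<longleftrightarrow>
      (\<exists>h W. riemannian_metric X \<A> h \<and> wind X \<A> h W \<and> solves_zermelo X \<A> h W F)"
  proof
    assume "randers_type X \<A> F"
    from randers_type_imp_solves_zermelo [OF assms(1) this]
    show "\<exists>h W. riemannian_metric X \<A> h \<and> wind X \<A> h W \<and> solves_zermelo X \<A> h W F"
      using strongly_convex_pos [OF assms] by blast
  qed (use solves_zermelo_imp_randers_type [OF assms(1,2)] in blast)
qed (use riemannian_type_iff_no_wind [OF assms(1,2)] in blast)

end
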